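(* Let $i,j$ be two non-negative real numbers with $i\ge j$ and $i+j=1$. Let $\mu$ and $R$ be real numbers satisfying $$\mu>2,\qquad R<j(\mu-2),\qquad R>\frac{\mu}{\mu-2},\qquad R>\frac{\mu}{i(\mu-1)}.$$ Let $(A_n)_{n\ge1}$ and $(B_n)_{n\ge1}$ be any pair of $(\mu,R)$-sequences, and let $$\boldsymbol{\theta}=(\theta_1,\theta_2)=\left(\sum_{n\ge1}A_n^{-1},\ \sum_{n\ge1}B_n^{-1}\right).$$ Then $$\hat{\omega}_{i,j}(\boldsymbol{\theta})=\min\left(2j\,\frac{\mu-1}{R},\ 2i\,\frac{\mu-1}{\mu}R\right),$$ $$\hat{\lambda}_{i,j}(\boldsymbol{\theta})=\min\left(\frac{1}{2i}\left(1-\frac{R}{\mu-1}\right),\ \frac{1}{2j}\left(1-\frac{\mu}{(\mu-1)R}\right)\right),$$ $$\omega_{i,j}(\boldsymbol{\theta})=2i(\mu-1).$$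
   Context: **$(\mu,R)$-sequences.** For real numbers $R>1$ and $\mu>1$, a pair of $(\mu,R)$-sequences is a pair of sequences of positive integers $(A_n)_{n\ge1}$ and $(B_n)_{n\ge1}$ such that: (i) there exist disjoint finite non-empty sets of prime numbers $S$ and $T$ such that, for each $n\ge1$, $S$ contains all the prime factors of $A_n$ and $T$ contains all the prime factors of $B_n$; (ii) for each $p\in S$ and $q\in T$, the sequences of $p$-adic and $q$-adic valuations $(\nu_p(A_n))_{n\ge1}$ and $(\nu_q(B_n))_{n\ge1}$ are strictly increasing sequences of positive integers; (iii) $\lim_{n\to\infty}\frac{\log A_{n+1}}{\log A_n}=\lim_{n\to\infty}\frac{\log B_{n+1}}{\log B_n}=\mu$ and $\lim_{n\to\infty}\frac{\log B_n}{\log A_n}=R$. **Twisted exponents.** Let $\boldsymbol{\theta}=(\theta_1,\theta_2)\in\mathbb{R}^2$ with $1,\theta_1,\theta_2$ linearly independent over $\mathbb{Q}$, and let $i,j\ge0$ be real with $i+j=1$. The exponent $\omega_{i,j}(\boldsymbol{\theta})$ (resp. the uniform exponent $\hat{\omega}_{i,j}(\boldsymbol{\theta})$) is the supremum of the real numbers $\nu$ such that, for arbitrarily large real $H$ (resp. for every sufficiently large real $H$), the system $$0<|q-p_1\theta_1-p_2\theta_2|\le H^{-\nu},\quad |p_1|\le H^{2i},\quad |p_2|\le H^{2j}$$ has an integer solution $(p_1,p_2,q)$ with $(p_1,p_2)\ne(0,0)$. The uniform exponent $\hat{\lambda}_{i,j}(\boldsymbol{\theta})$ is the supremum of the real numbers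 $\nu$ such that, for every sufficiently large real $H$, the system $$0<|q|\le H,\quad |q\theta_1-p_1|\le H^{-2i\nu},\quad |q\theta_2-p_2|\le H^{-2j\nu}$$ has an integer solution $(p_1,p_2,q)$. *)

theory Defs
  imports Complex_Main "HOL-Library.Extended_Real" "HOL-Computational_Algebra.Primes"
begin

text \<open>Sequences are indexed by \<open>n \<ge> 1\<close>; the values at index \<open>0\<close> are irrelevant.\<close>

definition mu_R_sequences :: "real \<Rightarrow> real \<Rightarrow> (nat \<Rightarrow> nat) \<Rightarrow> (nat \<Rightarrow> nat) \<Rightarrow> bool" where
  "mu_R_sequences \<mu> R A B \<longleftrightarrow>
     1 < \<mu> \<and> 1 < R \<and>
     (\<forall>n\<ge>1. 0 < A n \<and> 0 < B n) \<and>
     (\<exists>S T :: nat set.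
        finite S \<and> finite T \<and> S \<noteq> {} \<and> T \<noteq> {} \<and> S \<inter> T = {} \<and>
        (\<forall>p\<in>S. prime p) \<and> (\<forall>q\<in>T. prime q) \<and>
        (\<forall>n\<ge>1. prime_factors (A n) \<subseteq> S \<and> prime_factors (B n) \<subseteq> T) \<and>
        (\<forall>p\<in>S. strict_mono_on {1..} (\<lambda>n. multiplicity p (A n)) \<and>
                (\<forall>n\<ge>1. 0 < multiplicity p (A n))) \<and>
        (\<forall>q\<in>T. strict_mono_on {1..} (\<lambda>n. multiplicity q (B n)) \<and>
                (\<forall>n\<ge>1. 0 < multiplicity q (B n)))) \<and>
     (\<lambda>n. ln (real (A (n + 1))) / ln (real (A n))) \<longlonglongrightarrow> \<mu> \<and>
     (\<lambda>n. ln (real (B (n + 1))) / ln (real (B n))) \<longlonglongrightarrow> \<mu> \<and>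
     (\<lambda>n. ln (real (B n)) / ln (real (A n))) \<longlonglongrightarrow> R"

text \<open>The exponents are suprema in the extended reals, since the sets of admissible \<open>\<nu>\<close>
  need not be bounded. They are usually considered only when \<open>1, \<theta>\<^sub>1, \<theta>\<^sub>2\<close> are linearly
  independent over the rationals; the definitions below make sense for every \<open>\<theta>\<close>.\<close>

definition linear_form_solvable ::
    "real \<Rightarrow> real \<Rightarrow> real \<times> real \<Rightarrow> real \<Rightarrow> real \<Rightarrow> bool" where
  "linear_form_solvable i j \<theta> \<nu> H \<longleftrightarrow>
     (\<exists>p1 p2 q :: int. (p1, p2) \<noteq> (0, 0) \<and>
        0 < \<bar>of_int q - of_int p1 * fst \<theta> - of_int p2 * snd \<theta>\<bar> \<and>
        \<bar>of_int q - of_int p1 * fst \<theta> - of_int p2 * snd \<theta>\<bar> \<le> H powr (- \<nu>) \<and>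
        \<bar>of_int p1\<bar> \<le> H powr (2 * i) \<and> \<bar>of_int p2\<bar> \<le> H powr (2 * j))"

definition simultaneous_solvable ::
    "real \<Rightarrow> real \<Rightarrow> real \<times> real \<Rightarrow> real \<Rightarrow> real \<Rightarrow> bool" where
  "simultaneous_solvable i j \<theta> \<nu> H \<longleftrightarrow>
     (\<exists>p1 p2 q :: int. 0 < \<bar>of_int q :: real\<bar> \<and> \<bar>of_int q\<bar> \<le> H \<and>
        \<bar>of_int q * fst \<theta> - of_int p1\<bar> \<le> H powr (- 2 * i * \<nu>) \<and>
        \<bar>of_int q * snd \<theta> - of_int p2\<bar> \<le> H powr (- 2 * j * \<nu>))"

definition omega_exp :: "real \<Rightarrow> real \<Rightarrow> real \<times> real \<Rightarrow> ereal" where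
  "omega_exp i j \<theta> =
     Sup (ereal ` {\<nu>. \<exists>\<^sub>F H in at_top. linear_form_solvable i j \<theta> \<nu> H})"

definition omega_hat :: "real \<Rightarrow> real \<Rightarrow> real \<times> real \<Rightarrow> ereal" where
  "omega_hat i j \<theta> =
     Sup (ereal ` {\<nu>. \<forall>\<^sub>F H in at_top. linear_form_solvable i j \<theta> \<nu> H})"

definition lambda_hat :: "real \<Rightarrow> real \<Rightarrow> real \<times> real \<Rightarrow> ereal" where
  "lambda_hat i j \<theta> =
     Sup (ereal ` {\<nu>. \<forall>\<^sub>F H in at_top. simultaneous_solvable i j \<theta> \<nu> H})"

end

theory Submission
  imports Defs "HOL-Analysis.Kronecker_Approximation_Theorem"
begin

text \<open>
  Write \<open>\<alpha>\<^sub>n\<close> and \<open>\<beta>\<^sub>n\<close> for the partial sums of the two series. The valuations of \<open>A\<^sub>n\<close> increase at every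
  prime of \<open>S\<close>, so \<open>A\<^sub>n\<close> divides all later terms, \<open>\<alpha>\<^sub>n\<close> has exact denominator \<open>A\<^sub>n\<close>, and the remainder
  \<open>\<tau>\<^sub>n = \<theta>\<^sub>1 - \<alpha>\<^sub>n\<close> lies between \<open>1 / A\<^sub>n\<^sub>+\<^sub>1\<close> and \<open>2 / A\<^sub>n\<^sub>+\<^sub>1\<close>; likewise for \<open>\<beta>\<^sub>n\<close>, \<open>B\<^sub>n\<close> and \<open>\<sigma>\<^sub>n = \<theta>\<^sub>2 - \<beta>\<^sub>n\<close>.
  On the logarithmic scale on which \<open>A\<^sub>n\<close> has size \<open>1\<close>, the quantities \<open>B\<^sub>n\<close>, \<open>A\<^sub>n\<^sub>+\<^sub>1\<close>, \<open>B\<^sub>n\<^sub>+\<^sub>1\<close>, \<open>A\<^sub>n\<^sub>+\<^sub>2\<close> have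
  sizes \<open>R\<close>, \<open>\<mu>\<close>, \<open>\<mu> R\<close>, \<open>\<mu>\<^sup>2\<close>, the remainders \<open>\<tau>\<^sub>n\<close>, \<open>\<sigma>\<^sub>n\<close>, \<open>\<tau>\<^sub>n\<^sub>+\<^sub>1\<close> have sizes \<open>-\<mu>\<close>, \<open>-\<mu> R\<close>, \<open>-\<mu>\<^sup>2\<close>,
  and every asymptotic estimate below becomes an inequality between such exponents
  (\<open>has_order\<close>).

  The best linear forms are \<open>A\<^sub>n (\<theta>\<^sub>1 - \<alpha>\<^sub>n)\<close>, of size \<open>1 - \<mu>\<close>, and \<open>B\<^sub>n (\<theta>\<^sub>2 - \<beta>\<^sub>n)\<close>, of size \<open>R - \<mu> R\<close>.
  They become admissible at \<open>H = A\<^sub>n powr (1 / (2 i))\<close> and \<open>H = B\<^sub>n powr (1 / (2 j))\<close>, and these parameters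
  interlace. The first form yields the ordinary exponent; for the uniform exponent the critical \<open>H\<close>
  are those just before the next form becomes admissible, which gives the two terms of the
  minimum. That nothing does better is a denominator argument (\<open>linear_form_dichotomy\<close>): at the
  rational point \<open>(\<alpha>\<^sub>m, \<beta>\<^sub>n)\<close> an integer linear form either is at least \<open>1 / (A\<^sub>m B\<^sub>n)\<close> in absolute value,
  or vanishes, and then, because \<open>A\<^sub>m\<close> and \<open>B\<^sub>n\<close> are coprime, \<open>A\<^sub>m\<close> divides its first coefficient and
  \<open>B\<^sub>n\<close> its second. In the first case the hypotheses on \<open>\<mu>\<close> and \<open>R\<close> make the change from \<open>(\<alpha>\<^sub>m, \<beta>\<^sub>n)\<close> to
  \<open>(\<theta>\<^sub>1, \<theta>\<^sub>2)\<close> negligible; in the second the form is an integer combination of the two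
  best ones. It suffices to
  use the levels \<open>(n, n)\<close> and \<open>(n + 1, n)\<close>.

  For simultaneous approximation the best denominators are \<open>A\<^sub>n B\<^sub>n\<close> and \<open>A\<^sub>n\<^sub>+\<^sub>1 B\<^sub>n\<close>. In the gap between
  \<open>A\<^sub>n B\<^sub>n\<close> and \<open>A\<^sub>n\<^sub>+\<^sub>1 B\<^sub>n\<close> the multiples of \<open>B\<^sub>n\<close> take over from size \<open>\<mu> - 1\<close> on: they approximate \<open>\<theta>\<^sub>2\<close>
  well without further effort, and Dirichlet's theorem applied to \<open>B\<^sub>n \<theta>\<^sub>1\<close> selects one that is good for
  \<open>\<theta>\<^sub>1\<close> too (\<open>simultaneous_between_B\<close>). In the gap between \<open>A\<^sub>n\<^sub>+\<^sub>1 B\<^sub>n\<close> and \<open>A\<^sub>n\<^sub>+\<^sub>1 B\<^sub>n\<^sub>+\<^sub>1\<close> the multiples of \<open>A\<^sub>n\<^sub>+\<^sub>1\<close>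
  do the same from size \<open>(\<mu> - 1) R\<close> on. The two sizes where the regime changes are the critical ones:
  just below them a good denominator is forced to be a multiple of \<open>A\<^sub>n B\<^sub>n\<close>, respectively of
  \<open>A\<^sub>n\<^sub>+\<^sub>1 B\<^sub>n\<close> (\<open>rational_approximation_dvd\<close>), and this gives the two terms of the second minimum.
\<close>

section \<open>Thresholds and covers of a half-line\<close>

text \<open>The three exponents are suprema of this kind; only positive values below the threshold need to
  be tested because the threshold is positive.\<close>

lemma Sup_ereal_threshold:
  fixes c :: real
  assumes "0 < c" and "\<And>\<nu>. 0 < \<nu> \<Longrightarrow> \<nu> < c \<Longrightarrow> P \<nu>" and "\<And>\<nu>. c < \<nu> \<Longrightarrow> \<not> P \<nu>"
  shows "Sup (ereal ` {\<nu>. P \<nu>}) = ereal c"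
proof (rule antisym)
  show "Sup (ereal ` {\<nu>. P \<nu>}) \<le> ereal c"
    using assms(3) by (intro Sup_least) (auto simp: not_less[symmetric])
  show "ereal c \<le> Sup (ereal ` {\<nu>. P \<nu>})"
  proof (rule dense_le_bounded)
    show "0 < ereal c"
      using assms(1) by simp
    fix w assume w: "0 < w" "w < ereal c"
    then obtain \<nu> where \<nu>: "w = ereal \<nu>"
      by (cases w) auto
    with w assms(2) have "P \<nu>"
      by simp
    then show "w \<le> Sup (ereal ` {\<nu>. P \<nu>})"
      unfolding \<nu> by (intro Sup_upper) simp
  qed
qed

text \<open>Statements about every large \<open>H\<close> reduce to one block \<open>[X\<^sub>n, X\<^sub>n\<^sub>+\<^sub>1]\<close> at a time, on which the sizes of
  all quantities involved are known.\<close>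

lemma eventually_at_top_by_cover:
  fixes X :: "nat \<Rightarrow> real"
  assumes X: "filterlim X at_top sequentially"
    and P: "\<forall>\<^sub>F n in sequentially. \<forall>H. X n \<le> H \<and> H \<le> X (Suc n) \<longrightarrow> P H"
  shows "\<forall>\<^sub>F H in at_top. P H"
proof -
  obtain N where N: "\<And>n H. n \<ge> N \<Longrightarrow> X n \<le> H \<Longrightarrow> H \<le> X (Suc n) \<Longrightarrow> P H"
    using P unfolding eventually_sequentially by blast
  have "P H" if H: "X N \<le> H" for H
  proof -
    have "\<forall>\<^sub>F n in sequentially. H < X n"
      using X by (simp add: filterlim_at_top_dense)
    then obtain M where "\<And>n. n \<ge> M \<Longrightarrow> H < X n"
      unfolding eventually_sequentially by blast
    then have ex: "\<exists>d. H < X (N + d)"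
      by (intro exI[of _ M]) simp
    define d where "d = (LEAST d. H < X (N + d))"
    have d: "H < X (N + d)"
      unfolding d_def using ex by (rule LeastI_ex)
    then obtain e where e: "d = Suc e"
      using H by (cases d) auto
    then have "\<not> H < X (N + e)"
      using not_less_Least[of e "\<lambda>d. H < X (N + d)"] d_def by auto
    then show ?thesis
      using N[of "N + e" H] d e by simp
  qed
  then show ?thesis
    unfolding eventually_at_top_linorder by blast
qed

lemma not_eventually_at_top_by_sequence:
  fixes X :: "nat \<Rightarrow> real"
  assumes "filterlim X at_top sequentially" and "\<forall>\<^sub>F n in sequentially. \<not> P (X n)"
  shows "\<not> (\<forall>\<^sub>F H in at_top. P H)"
proof
  assume "\<forall>\<^sub>F H in at_top. P H"
  then have "\<forall>\<^sub>F n in sequentially. P (X n)"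
    using assms(1) by (rule eventually_compose_filterlim)
  with assms(2) have "\<forall>\<^sub>F n in sequentially. False"
    by eventually_elim simp
  then show False by simp
qed

lemma le_powr_of_root_le:
  fixes x H c :: real
  assumes "0 < c" and "0 \<le> x" and "x powr (1 / c) \<le> H"
  shows "x \<le> H powr c"
proof -
  have "x = (x powr (1 / c)) powr c"
    using assms by (simp add: powr_powr)
  also have "\<dots> \<le> H powr c"
    using assms by (intro powr_mono2) auto
  finally show ?thesis .
qed

lemma root_le_of_le_powr:
  fixes x H c :: real
  assumes "0 < c" and "0 \<le> x" and "0 \<le> H" and "x \<le> H powr c"
  shows "x powr (1 / c) \<le> H"
proof -
  have "x powr (1 / c) \<le> (H powr c) powr (1 / c)"
    using assms by (intro powr_mono2) auto
  also have "\<dots> = H"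
    using assms by (simp add: powr_powr)
  finally show ?thesis .
qed

section \<open>Orders of growth\<close>

text \<open>The meaning is \<open>f n = exp (c * a n + o (a n))\<close>. Constant factors have order \<open>0\<close> and are thus
  absorbed, which keeps the estimates below free of constants.\<close>

definition has_order :: "(nat \<Rightarrow> real) \<Rightarrow> (nat \<Rightarrow> real) \<Rightarrow> real \<Rightarrow> bool" where
  "has_order a f c \<longleftrightarrow>
     (\<forall>\<^sub>F n in sequentially. 0 < f n) \<and> (\<lambda>n. ln (f n) / a n) \<longlonglongrightarrow> c"

lemma has_order_pos: "has_order a f c \<Longrightarrow> \<forall>\<^sub>F n in sequentially. 0 < f n"
  by (simp add: has_order_def)

lemma has_order_cong:
  assumes "\<forall>\<^sub>F n in sequentially. f n = g n"
  shows "has_order a f c \<longleftrightarrow> has_order a g c"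
proof -
  have "(\<forall>\<^sub>F n in sequentially. 0 < f n) \<longleftrightarrow> (\<forall>\<^sub>F n in sequentially. 0 < g n)"
    using assms by (intro eventually_subst) (auto elim: eventually_mono)
  moreover have "((\<lambda>n. ln (f n) / a n) \<longlonglongrightarrow> c) \<longleftrightarrow> ((\<lambda>n. ln (g n) / a n) \<longlonglongrightarrow> c)"
    using assms by (intro tendsto_cong) (auto elim: eventually_mono)
  ultimately show ?thesis
    by (simp add: has_order_def)
qed

lemma has_order_mult:
  assumes "has_order a f c" and "has_order a g d"
  shows "has_order a (\<lambda>n. f n * g n) (c + d)"
  unfolding has_order_def
proof
  show "\<forall>\<^sub>F n in sequentially. 0 < f n * g n"
    using has_order_pos[OF assms(1)] has_order_pos[OF assms(2)] by eventually_elim simp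
  have "(\<lambda>n. ln (f n) / a n + ln (g n) / a n) \<longlonglongrightarrow> c + d"
    using assms by (auto simp: has_order_def intro: tendsto_add)
  moreover have "\<forall>\<^sub>F n in sequentially. ln (f n) / a n + ln (g n) / a n = ln (f n * g n) / a n"
    using has_order_pos[OF assms(1)] has_order_pos[OF assms(2)]
    by eventually_elim (simp add: ln_mult add_divide_distrib)
  ultimately show "(\<lambda>n. ln (f n * g n) / a n) \<longlonglongrightarrow> c + d"
    by (rule Lim_transform_eventually)
qed

lemma has_order_powr:
  assumes "has_order a f c"
  shows "has_order a (\<lambda>n. f n powr r) (r * c)"
  unfolding has_order_def
proof
  show "\<forall>\<^sub>F n in sequentially. 0 < f n powr r"
    using has_order_pos[OF assms(1)] by eventually_elim simp
  have "(\<lambda>n. r * (ln (f n) / a n)) \<longlonglongrightarrow> r * c"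
    using assms unfolding has_order_def by (intro tendsto_mult_left) blast
  moreover have "\<forall>\<^sub>F n in sequentially. r * (ln (f n) / a n) = ln (f n powr r) / a n"
    using has_order_pos[OF assms(1)] by eventually_elim (simp add: ln_powr)
  ultimately show "(\<lambda>n. ln (f n powr r) / a n) \<longlonglongrightarrow> r * c"
    by (rule Lim_transform_eventually)
qed

lemma has_order_divide:
  assumes "has_order a f c" and "has_order a g d"
  shows "has_order a (\<lambda>n. f n / g n) (c - d)"
proof -
  have "has_order a (\<lambda>n. f n * g n powr (- 1)) (c + (- 1) * d)"
    by (intro has_order_mult has_order_powr assms)
  moreover have "\<forall>\<^sub>F n in sequentially. f n * g n powr (- 1) = f n / g n"
    using has_order_pos[OF assms(2)]
    by eventually_elim (simp add: powr_minus divide_inverse)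
  ultimately have "has_order a (\<lambda>n. f n / g n) (c + (- 1) * d)"
    by (rule has_order_cong[THEN iffD1, rotated])
  then show ?thesis
    by simp
qed

lemma has_order_const:
  assumes "filterlim a at_top sequentially" and "0 < C"
  shows "has_order a (\<lambda>_. C) 0"
  unfolding has_order_def
  using assms real_tendsto_divide_at_top[OF tendsto_const assms(1)] by auto

lemma eventually_less_of_tendsto:
  fixes f g :: "nat \<Rightarrow> real"
  assumes "f \<longlonglongrightarrow> c" and "g \<longlonglongrightarrow> d" and "c < d"
  shows "\<forall>\<^sub>F n in sequentially. f n < g n"
proof -
  obtain e where "c < e" "e < d"
    using dense[OF assms(3)] by blast
  then have "\<forall>\<^sub>F n in sequentially. f n < e" "\<forall>\<^sub>F n in sequentially. e < g n"
    using assms(1,2) by (simp_all add: order_tendstoD)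
  then show ?thesis
    by eventually_elim simp
qed

lemma has_order_eventually_less:
  assumes a: "filterlim a at_top sequentially"
    and f: "has_order a f c" and g: "has_order a g d" and "c < d"
  shows "\<forall>\<^sub>F n in sequentially. f n < g n"
proof -
  have "\<forall>\<^sub>F n in sequentially. ln (f n) / a n < ln (g n) / a n"
    using f g \<open>c < d\<close> unfolding has_order_def by (intro eventually_less_of_tendsto) simp_all
  moreover have "\<forall>\<^sub>F n in sequentially. 0 < a n"
    using a by (simp add: filterlim_at_top_dense)
  ultimately show ?thesis
    using has_order_pos[OF f] has_order_pos[OF g]
    by eventually_elim (simp add: divide_less_cancel)
qed

lemma has_order_squeeze:
  assumes a: "filterlim a at_top sequentially"
    and "has_order a f c" and "has_order a h c"
    and "\<forall>\<^sub>F n in sequentially. f n \<le> g n" and "\<forall>\<^sub>F n in sequentially. g n \<le> h n"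
  shows "has_order a g c"
  unfolding has_order_def
proof
  show pos: "\<forall>\<^sub>F n in sequentially. 0 < g n"
    using has_order_pos[OF assms(2)] assms(4) by eventually_elim simp
  have a0: "\<forall>\<^sub>F n in sequentially. 0 < a n"
    using a by (simp add: filterlim_at_top_dense)
  show "(\<lambda>n. ln (g n) / a n) \<longlonglongrightarrow> c"
  proof (rule tendsto_sandwich)
    show "\<forall>\<^sub>F n in sequentially. ln (f n) / a n \<le> ln (g n) / a n"
      using has_order_pos[OF assms(2)] assms(4) a0
      by eventually_elim (simp add: divide_right_mono)
    show "\<forall>\<^sub>F n in sequentially. ln (g n) / a n \<le> ln (h n) / a n"
      using pos assms(5) a0 by eventually_elim (simp add: divide_right_mono)
  qed (use assms in \<open>auto simp: has_order_def\<close>)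
qed

lemma has_order_at_top:
  assumes a: "filterlim a at_top sequentially" and f: "has_order a f c" and "0 < c"
  shows "filterlim f at_top sequentially"
  unfolding filterlim_at_top_dense
proof
  fix Z :: real
  have "\<forall>\<^sub>F n in sequentially. max Z 1 < f n"
    by (rule has_order_eventually_less[OF a has_order_const[OF a] f \<open>0 < c\<close>]) simp
  then show "\<forall>\<^sub>F n in sequentially. Z < f n"
    by eventually_elim (rule le_less_trans[OF max.cobounded1])
qed

section \<open>Series of unit fractions with a fixed set of primes\<close>

text \<open>Index \<open>0\<close> carries no information, hence the restrictions to positive indices.\<close>

locale unit_fraction_series =
  fixes A :: "nat \<Rightarrow> nat" and S :: "nat set"
  assumes pos: "n \<ge> 1 \<Longrightarrow> 0 < A n"
    and nonempty: "S \<noteq> {}"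
    and prime: "p \<in> S \<Longrightarrow> prime p"
    and factors: "n \<ge> 1 \<Longrightarrow> prime_factors (A n) \<subseteq> S"
    and valuation_mono: "p \<in> S \<Longrightarrow> strict_mono_on {1..} (\<lambda>n. multiplicity p (A n))"
begin

definition value_of_series :: real where
  "value_of_series = (\<Sum>n. 1 / real (A (Suc n)))"

definition tail :: "nat \<Rightarrow> real" where
  "tail n = value_of_series - (\<Sum>k<n. 1 / real (A (Suc k)))"

definition numerator :: "nat \<Rightarrow> nat" where
  "numerator n = (\<Sum>k<n. A n div A (Suc k))"

lemma valuation_less:
  "p \<in> S \<Longrightarrow> 1 \<le> m \<Longrightarrow> m < n \<Longrightarrow> multiplicity p (A m) < multiplicity p (A n)"
  using valuation_mono[of p] by (auto dest!: strict_mono_onD[where r = m and s = n])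

lemma dvd_later:
  assumes "1 \<le> m" and "m \<le> n"
  shows "A m dvd A n"
proof (rule multiplicity_le_imp_dvd)
  show "A m \<noteq> 0"
    using pos[of m] assms by simp
  fix p :: nat
  assume p: "prime p"
  show "multiplicity p (A m) \<le> multiplicity p (A n)"
  proof (cases "p \<in> S")
    case True
    then show ?thesis
      using valuation_less[of p m n] assms by (cases "m = n") auto
  next
    case False
    then have "p \<notin> prime_factors (A m)"
      using factors[of m] assms by auto
    then show ?thesis
      using p by (auto simp: prime_factors_multiplicity)
  qed
qed

lemma prime_dvd_quotient:
  assumes "p \<in> S" and "1 \<le> m" and "m < n"
  shows "p dvd A n div A m"
proof -
  obtain k where k: "A n = A m * k"
    using dvd_later[of m n] assms by (auto elim: dvdE)
  have nz: "A m \<noteq> 0" "k \<noteq> 0"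
    using pos[of m] pos[of n] assms k by auto
  \<comment> \<open>The quotient absorbs the strict increase of the valuation.\<close>
  have "multiplicity p (A n) = multiplicity p (A m) + multiplicity p k"
    unfolding k using nz prime[OF assms(1)] by (simp add: prime_elem_multiplicity_mult_distrib)
  then have "multiplicity p k > 0"
    using valuation_less[OF assms] by simp
  then have "p dvd k"
    using not_dvd_imp_multiplicity_0 by force
  then show ?thesis
    using k nz by simp
qed

text \<open>The quotient of consecutive terms is divisible by some prime of \<open>S\<close>. The resulting geometric
  growth makes each remainder of the series comparable to its first term.\<close>

lemma double_le_Suc:
  assumes "1 \<le> n"
  shows "2 * A n \<le> A (Suc n)"
proof -
  obtain p where p: "p \<in> S"
    using nonempty by blast
  obtain k where k: "A (Suc n) = A n * k"
    using dvd_later[of n "Suc n"] assms by (auto elim: dvdE)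
  have "k \<noteq> 0" "p dvd k"
    using prime_dvd_quotient[OF p assms, of "Suc n"] k pos[OF assms] pos[of "Suc n"] by auto
  then have "2 \<le> k"
    using prime_ge_2_nat[OF prime[OF p]] by (auto dest: dvd_imp_le)
  then show ?thesis
    by (simp add: k)
qed

lemma geometric_le:
  assumes "1 \<le> n"
  shows "2 ^ k * A n \<le> A (k + n)"
proof (induction k)
  case (Suc k)
  then show ?case
    using double_le_Suc[of "k + n"] assms by simp
qed simp

lemma A_at_top: "filterlim (\<lambda>n. real (A n)) at_top sequentially"
proof (rule filterlim_at_top_mono[OF filterlim_real_sequentially])
  have "real n \<le> real (A n)" if "1 \<le> n" for n
  proof -
    obtain k where k: "n = Suc k"
      using \<open>1 \<le> n\<close> by (cases n) auto
    have "n \<le> 2 ^ k"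
      using less_exp[of k] k by (simp only: Suc_le_eq)
    also have "\<dots> \<le> 2 ^ k * A 1"
      using pos[of 1] by simp
    also have "\<dots> \<le> A n"
      using geometric_le[of 1 k] k by simp
    finally show ?thesis
      by simp
  qed
  then show "\<forall>\<^sub>F n in sequentially. real n \<le> real (A n)"
    unfolding eventually_sequentially by blast
qed

lemma unit_fraction_le:
  assumes "1 \<le> n"
  shows "1 / real (A (k + n)) \<le> (1 / 2) ^ k * (1 / real (A n))"
proof -
  have "2 ^ k * real (A n) \<le> real (A (k + n))"
    using geometric_le[OF assms, of k] by (simp flip: of_nat_le_iff[where 'a = real])
  then have "1 / real (A (k + n)) \<le> 1 / (2 ^ k * real (A n))"
    using pos[OF assms] by (intro divide_left_mono) (use pos[of "k + n"] assms in auto)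
  then show ?thesis
    by (simp add: power_one_over)
qed

lemma sums_half_powers: "(\<lambda>k. (1 / 2 :: real) ^ k * c) sums (2 * c)"
  using sums_mult2[OF geometric_sums[of "1 / 2 :: real"], of c] by simp

lemma summable_unit_fractions: "summable (\<lambda>k. 1 / real (A (Suc k)))"
  using unit_fraction_le[of 1]
  by (intro summable_comparison_test'[OF sums_summable[OF sums_half_powers[of "1 / real (A 1)"]], of 0]) simp

lemma tail_eq: "tail n = (\<Sum>k. 1 / real (A (k + Suc n)))"
  using suminf_minus_initial_segment[OF summable_unit_fractions, of n]
  by (simp add: tail_def value_of_series_def)

lemma tail_bounds: "1 / real (A (Suc n)) \<le> tail n" "tail n \<le> 2 / real (A (Suc n))"
proof -
  have summable: "summable (\<lambda>k. 1 / real (A (k + Suc n)))"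
    using summable_unit_fractions summable_iff_shift[of "\<lambda>k. 1 / real (A (Suc k))" n] by simp
  show "1 / real (A (Suc n)) \<le> tail n"
    unfolding tail_eq using sum_le_suminf[OF summable, of "{0}"] by simp
  have "tail n \<le> (\<Sum>k. (1 / 2) ^ k * (1 / real (A (Suc n))))"
    unfolding tail_eq
    by (intro suminf_le summable sums_summable[OF sums_half_powers] unit_fraction_le) simp
  also have "\<dots> = 2 * (1 / real (A (Suc n)))"
    using sums_unique[OF sums_half_powers[of "1 / real (A (Suc n))"]] by simp
  finally show "tail n \<le> 2 / real (A (Suc n))"
    by simp
qed

lemma tail_pos: "0 < tail n"
  using tail_bounds(1)[of n] pos[of "Suc n"] by (auto intro: less_le_trans[rotated])

lemma A_times_value:
  assumes "1 \<le> n"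
  shows "real (A n) * value_of_series = real (numerator n) + real (A n) * tail n"
proof -
  have "real (A n) * (\<Sum>k<n. 1 / real (A (Suc k))) = (\<Sum>k<n. real (A n div A (Suc k)))"
    unfolding sum_distrib_left
  proof (rule sum.cong)
    fix k assume "k \<in> {..<n}"
    then show "real (A n) * (1 / real (A (Suc k))) = real (A n div A (Suc k))"
      using dvd_later[of "Suc k" n] by (simp add: real_of_nat_div)
  qed simp
  then show ?thesis
    by (simp add: tail_def numerator_def right_diff_distrib)
qed

text \<open>In the numerator, the summands that come from earlier terms are divisible by every prime of \<open>S\<close>, and
  the last summand is \<open>1\<close>.\<close>

lemma coprime_numerator:
  assumes "1 \<le> n"
  shows "coprime (A n) (numerator n)"
proof (rule ccontr)
  assume "\<not> coprime (A n) (numerator n)"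
  then obtain p where "prime p" "p dvd gcd (A n) (numerator n)"
    using prime_factor_nat[of "gcd (A n) (numerator n)"] by (auto simp: coprime_iff_gcd_eq_1)
  then have p: "prime p" "p dvd A n" "p dvd numerator n"
    by simp_all
  then have S: "p \<in> S"
    using factors[OF assms] pos[OF assms] by (auto simp: in_prime_factors_iff)
  obtain m where m: "n = Suc m"
    using assms by (cases n) auto
  have "p dvd (\<Sum>k<m. A n div A (Suc k))"
    using S by (intro dvd_sum prime_dvd_quotient) (auto simp: m)
  moreover have "numerator n = (\<Sum>k<m. A n div A (Suc k)) + 1"
    using pos[OF assms] by (simp add: numerator_def m)
  ultimately have "p dvd 1"
    using p(3) dvd_add_right_iff by metis
  with p(1) show False
    by simp
qed

text \<open>The integer \<open>q * numerator n - A n * p\<close> is smaller than \<open>1\<close> in absolute value, hence zero: a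
  fraction that is close enough to the sum of the series must be equal to the \<open>n\<close>-th partial sum.
  Its denominator is then a multiple of \<open>A n\<close>, and its error is exactly that of the partial sum.\<close>

lemma rational_approximation_dvd:
  fixes q p :: int
  assumes "1 \<le> n"
    and small: "real (A n) * \<bar>of_int q * value_of_series - of_int p\<bar>
      + \<bar>of_int q\<bar> * (real (A n) * tail n) < 1"
  shows "int (A n) dvd q" and "of_int q * value_of_series - of_int p = of_int q * tail n"
proof -
  let ?D = "q * int (numerator n) - int (A n) * p"
  have D: "real_of_int ?D
      = real (A n) * (of_int q * value_of_series - of_int p) - of_int q * (real (A n) * tail n)"
    using A_times_value[OF assms(1)] by (simp add: algebra_simps)
  have "\<bar>real_of_int ?D\<bar> < 1"
    unfolding D using small abs_triangle_ineq4[of "real (A n) * (of_int q * value_of_series - of_int p)"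
        "of_int q * (real (A n) * tail n)"] tail_pos[of n]
    by (simp add: abs_mult)
  then have "?D = 0"
    by linarith
  then have eq: "q * int (numerator n) = int (A n) * p"
    by simp
  moreover have "coprime (int (A n)) (int (numerator n))"
    using coprime_numerator[OF assms(1)] by simp
  ultimately show "int (A n) dvd q"
    by (metis coprime_dvd_mult_left_iff dvd_triv_left)
  have "real (A n) * (of_int q * value_of_series - of_int p) = real (A n) * (of_int q * tail n)"
    using D \<open>?D = 0\<close> by simp
  then show "of_int q * value_of_series - of_int p = of_int q * tail n"
    using pos[OF assms(1)] by simp
qed

end

section \<open>Two series with disjoint sets of primes\<close>

lemma linear_form_solvable_swap:
  assumes "linear_form_solvable j i (b, a) \<nu> H"
  shows "linear_form_solvable i j (a, b) \<nu> H"
proof -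
  obtain p1 p2 q :: int where p: "(p1, p2) \<noteq> (0, 0)"
    and L: "0 < \<bar>of_int q - of_int p1 * b - of_int p2 * a\<bar>"
      "\<bar>of_int q - of_int p1 * b - of_int p2 * a\<bar> \<le> H powr (- \<nu>)"
    and bounds: "\<bar>of_int p1\<bar> \<le> H powr (2 * j)" "\<bar>of_int p2\<bar> \<le> H powr (2 * i)"
    using assms unfolding linear_form_solvable_def by auto
  have "of_int q - of_int p1 * b - of_int p2 * a = of_int q - of_int p2 * a - of_int p1 * b"
    by simp
  with p L bounds show ?thesis
    unfolding linear_form_solvable_def fst_conv snd_conv
    by - (rule exI[of _ p2], rule exI[of _ p1], rule exI[of _ q], auto)
qed

lemma simultaneous_solvable_swap:
  "simultaneous_solvable j i (b, a) \<nu> H \<Longrightarrow> simultaneous_solvable i j (a, b) \<nu> H"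
  unfolding simultaneous_solvable_def by auto

text \<open>Dirichlet's theorem for \<open>Q * \<xi>\<close>: up to the factor \<open>2\<close>, which pays for rounding \<open>H / Q\<close> to an integer,
  multiples of \<open>Q\<close> approximate as if \<open>H / Q\<close> were the available height.\<close>

lemma Dirichlet_multiple:
  fixes \<xi> H :: real and Q :: nat
  assumes "0 < Q" and "real Q \<le> H"
  obtains k p :: int where "0 < k" and "of_int k * real Q \<le> H"
    and "\<bar>of_int (k * int Q) * \<xi> - of_int p\<bar> \<le> 2 * real Q / H"
proof -
  define N where "N = nat \<lfloor>H / real Q\<rfloor>"
  have ge1: "1 \<le> H / real Q"
    using assms by simp
  then have N: "0 < N" "real N \<le> H / real Q" "H / real Q < real N + 1"
    unfolding N_def by linarith+
  obtain p k where k: "0 < k" "k \<le> int N" "\<bar>of_int k * (real Q * \<xi>) - of_int p\<bar> < 1 / real N"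
    using Dirichlet_approx[OF N(1)] by blast
  show thesis
  proof (rule that)
    have "of_int k \<le> H / real Q"
      using k(2) N(2) by linarith
    then show "of_int k * real Q \<le> H"
      using assms(1) by (simp add: le_divide_eq)
    have "H / real Q \<le> 2 * real N"
      using N by linarith
    then have "1 / real N \<le> 2 * real Q / H"
      using assms N(1) by (simp add: field_simps)
    then show "\<bar>of_int (k * int Q) * \<xi> - of_int p\<bar> \<le> 2 * real Q / H"
      using k(3) by (simp add: mult.assoc)
  qed (rule k(1))
qed

locale unit_fraction_pair =
  X: unit_fraction_series A S + Y: unit_fraction_series B T
  for A B :: "nat \<Rightarrow> nat" and S T :: "nat set" +
  assumes disjoint: "S \<inter> T = {}"
begin

abbreviation "\<xi> \<equiv> X.value_of_series"
abbreviation "\<eta> \<equiv> Y.value_of_series"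
abbreviation "\<tau> \<equiv> X.tail"
abbreviation "\<sigma> \<equiv> Y.tail"

lemma coprime_A_B:
  assumes "1 \<le> m" and "1 \<le> n"
  shows "coprime (A m) (B n)"
proof (rule ccontr)
  assume "\<not> coprime (A m) (B n)"
  then obtain p where "prime p" "p dvd gcd (A m) (B n)"
    using prime_factor_nat[of "gcd (A m) (B n)"] by (auto simp: coprime_iff_gcd_eq_1)
  then have "p \<in> prime_factors (A m)" "p \<in> prime_factors (B n)"
    using X.pos[OF assms(1)] Y.pos[OF assms(2)] by (auto simp: in_prime_factors_iff)
  then show False
    using X.factors[OF assms(1)] Y.factors[OF assms(2)] disjoint by blast
qed

text \<open>Replace \<open>\<xi>\<close> and \<open>\<eta>\<close> by their partial sums and multiply by the common denominator \<open>A m * B n\<close>. The result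
  is an integer \<open>N\<close>. If \<open>N\<close> is nonzero, it is at least \<open>1\<close> in absolute value; if it vanishes,
  coprimality of the two denominators gives the divisibilities, and of \<open>L\<close> only the remainders are left.\<close>

lemma linear_form_dichotomy:
  fixes p1 p2 q :: int
  assumes "1 \<le> m" and "1 \<le> n"
  defines "L \<equiv> of_int q - of_int p1 * \<xi> - of_int p2 * \<eta>"
  shows "1 / (real (A m) * real (B n)) \<le> \<bar>L\<bar> + \<bar>of_int p1\<bar> * \<tau> m + \<bar>of_int p2\<bar> * \<sigma> n \<or>
    int (A m) dvd p1 \<and> int (B n) dvd p2 \<and> L = - (of_int p1 * \<tau> m + of_int p2 * \<sigma> n)"
proof -
  let ?a = "int (A m)" and ?b = "int (B n)"
  let ?u = "int (X.numerator m)" and ?v = "int (Y.numerator n)"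
  define N where "N = q * (?a * ?b) - p1 * (?u * ?b) - p2 * (?v * ?a)"
  define D where "D = L + of_int p1 * \<tau> m + of_int p2 * \<sigma> n"
  have pos: "0 < real (A m) * real (B n)"
    using X.pos[OF assms(1)] Y.pos[OF assms(2)] by simp
  have N: "of_int N = real (A m) * real (B n) * D"
  proof -
    have "of_int N = of_int q * (real (A m) * real (B n))
        - of_int p1 * (real (X.numerator m) * real (B n))
        - of_int p2 * (real (Y.numerator n) * real (A m))"
      by (simp add: N_def)
    also have "real (X.numerator m) = real (A m) * \<xi> - real (A m) * \<tau> m"
      using X.A_times_value[OF assms(1)] by simp
    also have "real (Y.numerator n) = real (B n) * \<eta> - real (B n) * \<sigma> n"
      using Y.A_times_value[OF assms(2)] by simp
    finally show ?thesis
      by (simp add: D_def L_def algebra_simps)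
  qed
  show ?thesis
  proof (cases "N = 0")
    case False
    then have "1 \<le> \<bar>real_of_int N\<bar>"
      by linarith
    then have "1 \<le> real (A m) * real (B n) * \<bar>D\<bar>"
      unfolding N using pos by (simp add: abs_mult)
    then have "1 / (real (A m) * real (B n)) \<le> \<bar>D\<bar>"
      using pos by (simp add: divide_le_eq mult.commute)
    also have "\<bar>D\<bar> \<le> \<bar>L\<bar> + \<bar>of_int p1 * \<tau> m\<bar> + \<bar>of_int p2 * \<sigma> n\<bar>"
      unfolding D_def by linarith
    finally show ?thesis
      using X.tail_pos[of m] Y.tail_pos[of n] by (simp add: abs_mult)
  next
    case True
    have ab: "coprime ?a ?b" "coprime ?a ?u" "coprime ?b ?v"
      using coprime_A_B[OF assms(1,2)] X.coprime_numerator[OF assms(1)]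
        Y.coprime_numerator[OF assms(2)] by simp_all
    have "p1 * (?u * ?b) = ?a * (q * ?b - p2 * ?v)" "p2 * (?v * ?a) = ?b * (q * ?a - p1 * ?u)"
      using True by (simp_all add: N_def algebra_simps)
    then have "?a dvd p1 * (?u * ?b)" "?b dvd p2 * (?v * ?a)"
      by simp_all
    then have "?a dvd p1" "?b dvd p2"
      using ab by (simp_all add: coprime_dvd_mult_left_iff coprime_commute)
    moreover have "D = 0"
      using N True pos by (metis mult_eq_0_iff of_int_0 order_less_irrefl)
    ultimately show ?thesis
      by (simp add: D_def)
  qed
qed

lemma linear_form_solvable_A:
  assumes "1 \<le> n" and "real (A n) \<le> H powr (2 * i)" and "real (A n) * \<tau> n \<le> H powr (- \<nu>)"
  shows "linear_form_solvable i j (\<xi>, \<eta>) \<nu> H"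
  unfolding linear_form_solvable_def
proof (intro exI conjI)
  let ?L = "\<bar>of_int (- int (X.numerator n)) - of_int (- int (A n)) * fst (\<xi>, \<eta>)
    - of_int 0 * snd (\<xi>, \<eta>) :: real\<bar>"
  have L: "?L = real (A n) * \<tau> n"
    using X.A_times_value[OF assms(1)] X.tail_pos[of n] by simp
  show "?L \<le> H powr (- \<nu>)" "0 < ?L"
    unfolding L using assms(3) X.tail_pos[of n] X.pos[OF assms(1)] by simp_all
qed (use assms X.pos[OF assms(1)] in simp_all)

lemma linear_form_solvable_B:
  assumes "1 \<le> n" and "real (B n) \<le> H powr (2 * j)" and "real (B n) * \<sigma> n \<le> H powr (- \<nu>)"
  shows "linear_form_solvable i j (\<xi>, \<eta>) \<nu> H"
proof -
  interpret swapped: unit_fraction_pair B A T S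
    using disjoint by unfold_locales auto
  show ?thesis
    using assms by (intro linear_form_solvable_swap[OF swapped.linear_form_solvable_A])
qed

text \<open>The three bounds correspond to the cases of \<open>linear_form_dichotomy\<close>: the form does not vanish at
  the rational point; it vanishes there and involves a nonzero multiple of \<open>A m\<close>; it vanishes there and
  is a nonzero multiple of \<open>B n\<close> alone. The last two cases occur only if \<open>H\<close> leaves room for such a
  coefficient.\<close>

lemma not_linear_form_solvable:
  assumes mn: "1 \<le> m" "1 \<le> n"
    and generic: "H powr (- \<nu>) + H powr (2 * i) * \<tau> m + H powr (2 * j) * \<sigma> n
      < 1 / (real (A m) * real (B n))"
    and A: "real (A m) \<le> H powr (2 * i) \<Longrightarrow>
      H powr (- \<nu>) + H powr (2 * j) * \<sigma> n < real (A m) * \<tau> m"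
    and B: "real (B n) \<le> H powr (2 * j) \<Longrightarrow> H powr (- \<nu>) < real (B n) * \<sigma> n"
  shows "\<not> linear_form_solvable i j (\<xi>, \<eta>) \<nu> H"
proof
  assume "linear_form_solvable i j (\<xi>, \<eta>) \<nu> H"
  then obtain p1 p2 q :: int where p: "(p1, p2) \<noteq> (0, 0)"
    and L: "\<bar>of_int q - of_int p1 * \<xi> - of_int p2 * \<eta>\<bar> \<le> H powr (- \<nu>)" (is "\<bar>?L\<bar> \<le> _")
    and p1: "\<bar>of_int p1\<bar> \<le> H powr (2 * i)" and p2: "\<bar>of_int p2\<bar> \<le> H powr (2 * j)"
    unfolding linear_form_solvable_def by auto
  note tails = X.tail_pos[of m] Y.tail_pos[of n]
  have p1\<tau>: "\<bar>of_int p1\<bar> * \<tau> m \<le> H powr (2 * i) * \<tau> m"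
    using p1 tails by (intro mult_right_mono) auto
  have p2\<sigma>: "\<bar>of_int p2\<bar> * \<sigma> n \<le> H powr (2 * j) * \<sigma> n"
    using p2 tails by (intro mult_right_mono) auto
  have "\<not> 1 / (real (A m) * real (B n)) \<le> \<bar>?L\<bar> + \<bar>of_int p1\<bar> * \<tau> m + \<bar>of_int p2\<bar> * \<sigma> n"
    using generic L p1\<tau> p2\<sigma> by linarith
  then have dvd: "int (A m) dvd p1" "int (B n) dvd p2"
    and L_eq: "?L = - (of_int p1 * \<tau> m + of_int p2 * \<sigma> n)"
    using linear_form_dichotomy[OF mn, of q p1 p2] by blast+
  show False
  proof (cases "p1 = 0")
    case False
    then have "int (A m) \<le> \<bar>p1\<bar>"
      using dvd(1) by (simp add: zdvd_imp_le)
    then have le: "real (A m) \<le> \<bar>of_int p1\<bar>"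
      by linarith
    then have "real (A m) * \<tau> m \<le> \<bar>of_int p1 * \<tau> m\<bar>"
      using tails by (simp add: abs_mult)
    moreover have "\<bar>of_int p2 * \<sigma> n\<bar> \<le> H powr (2 * j) * \<sigma> n"
      using p2\<sigma> tails by (simp add: abs_mult)
    moreover have "H powr (- \<nu>) + H powr (2 * j) * \<sigma> n < real (A m) * \<tau> m"
      using le p1 by (intro A) linarith
    ultimately show False
      using L L_eq by linarith
  next
    case True
    then have "int (B n) \<le> \<bar>p2\<bar>"
      using dvd(2) p by (simp add: zdvd_imp_le)
    then have le: "real (B n) \<le> \<bar>of_int p2\<bar>"
      by linarith
    then have "real (B n) * \<sigma> n \<le> \<bar>of_int p2 * \<sigma> n\<bar>"
      using tails by (simp add: abs_mult)
    moreover have "H powr (- \<nu>) < real (B n) * \<sigma> n"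
      using le p2 by (intro B) linarith
    ultimately show False
      using L L_eq True by simp
  qed
qed

lemma simultaneous_solvable_product:
  assumes "1 \<le> m" and "1 \<le> n" and "real (A m) * real (B n) \<le> H"
    and "real (A m) * real (B n) * \<tau> m \<le> H powr (- 2 * i * \<nu>)"
    and "real (A m) * real (B n) * \<sigma> n \<le> H powr (- 2 * j * \<nu>)"
  shows "simultaneous_solvable i j (\<xi>, \<eta>) \<nu> H"
  unfolding simultaneous_solvable_def
proof (intro exI conjI)
  let ?q = "int (A m) * int (B n)"
  have "of_int ?q * fst (\<xi>, \<eta>) - of_int (int (B n) * int (X.numerator m))
      = real (B n) * (real (A m) * \<xi> - real (X.numerator m))"
    by (simp add: algebra_simps)
  also have "\<dots> = real (A m) * real (B n) * \<tau> m"
    using X.A_times_value[OF assms(1)] by simp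
  finally show "\<bar>of_int ?q * fst (\<xi>, \<eta>) - of_int (int (B n) * int (X.numerator m))\<bar>
      \<le> H powr (- 2 * i * \<nu>)"
    using assms(4) X.tail_pos[of m] by simp
  have "of_int ?q * snd (\<xi>, \<eta>) - of_int (int (A m) * int (Y.numerator n))
      = real (A m) * (real (B n) * \<eta> - real (Y.numerator n))"
    by (simp add: algebra_simps)
  also have "\<dots> = real (A m) * real (B n) * \<sigma> n"
    using Y.A_times_value[OF assms(2)] by simp
  finally show "\<bar>of_int ?q * snd (\<xi>, \<eta>) - of_int (int (A m) * int (Y.numerator n))\<bar>
      \<le> H powr (- 2 * j * \<nu>)"
    using assms(5) Y.tail_pos[of n] by simp
qed (use assms X.pos[OF assms(1)] Y.pos[OF assms(2)] in simp_all)

text \<open>Both errors of the denominator \<open>A m * B n\<close> are independent of \<open>H\<close> while the requirements sharpen as \<open>H\<close>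
  grows, so the right end of the range decides.\<close>

lemma simultaneous_until:
  assumes "1 \<le> m" and "1 \<le> n" and "real (A m) * real (B n) \<le> H" and "H \<le> V" and "0 \<le> \<nu>"
    and "0 \<le> i" and "0 \<le> j"
    and "real (A m) * real (B n) * \<tau> m \<le> V powr (- 2 * i * \<nu>)"
    and "real (A m) * real (B n) * \<sigma> n \<le> V powr (- 2 * j * \<nu>)"
  shows "simultaneous_solvable i j (\<xi>, \<eta>) \<nu> H"
proof -
  have "0 < real (A m) * real (B n)"
    using X.pos[OF assms(1)] Y.pos[OF assms(2)] by simp
  then have "V powr (- 2 * i * \<nu>) \<le> H powr (- 2 * i * \<nu>)" "V powr (- 2 * j * \<nu>) \<le> H powr (- 2 * j * \<nu>)"
    using assms by (auto intro!: powr_mono2')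
  then show ?thesis
    using assms by (intro simultaneous_solvable_product) auto
qed

lemma simultaneous_solvable_multiple_of_A:
  assumes "1 \<le> n" and "real (A n) \<le> H" and "H * \<tau> n \<le> H powr (- 2 * i * \<nu>)"
    and "2 * real (A n) / H \<le> H powr (- 2 * j * \<nu>)"
  shows "simultaneous_solvable i j (\<xi>, \<eta>) \<nu> H"
proof -
  obtain k p :: int where k: "0 < k" "of_int k * real (A n) \<le> H"
    and p: "\<bar>of_int (k * int (A n)) * \<eta> - of_int p\<bar> \<le> 2 * real (A n) / H"
    using Dirichlet_multiple[OF X.pos[OF assms(1)] assms(2)] by blast
  have "of_int (k * int (A n)) * \<xi> - of_int (k * int (X.numerator n))
      = of_int k * (real (A n) * \<xi> - real (X.numerator n))"
    by (simp add: algebra_simps)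
  also have "\<dots> = of_int k * real (A n) * \<tau> n"
    using X.A_times_value[OF assms(1)] by simp
  finally have "\<bar>of_int (k * int (A n)) * \<xi> - of_int (k * int (X.numerator n))\<bar>
      = of_int k * real (A n) * \<tau> n"
    using k(1) X.tail_pos[of n] by simp
  moreover have "of_int k * real (A n) * \<tau> n \<le> H * \<tau> n"
    using k(2) X.tail_pos[of n] by (intro mult_right_mono) auto
  ultimately show ?thesis
    unfolding simultaneous_solvable_def fst_conv snd_conv
    using p k assms X.pos[OF assms(1)]
    by - (rule exI[of _ "k * int (X.numerator n)"], rule exI[of _ p], rule exI[of _ "k * int (A n)"],
          intro conjI, force, force, linarith+)
qed

text \<open>Among the multiples of \<open>A n\<close> up to \<open>H\<close>, the error in \<open>\<xi>\<close> is at most \<open>H * \<tau> n\<close>, and Dirichlet's theorem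
  brings the error in \<open>\<eta>\<close> below \<open>2 * A n / H\<close>. The first bound is critical at the right end \<open>V\<close> of the range, the
  second at the left end \<open>U\<close>.\<close>

lemma simultaneous_between_A:
  assumes "1 \<le> n" and "real (A n) \<le> U" and H: "U \<le> H" "H \<le> V"
    and "0 \<le> 1 + 2 * i * \<nu>" and "0 \<le> 1 - 2 * j * \<nu>"
    and V: "V powr (1 + 2 * i * \<nu>) * \<tau> n \<le> 1"
    and U: "2 * real (A n) \<le> U powr (1 - 2 * j * \<nu>)"
  shows "simultaneous_solvable i j (\<xi>, \<eta>) \<nu> H"
proof (rule simultaneous_solvable_multiple_of_A)
  have pos: "0 < H"
    using X.pos[OF assms(1)] assms(2) H by linarith
  have "H powr (1 + 2 * i * \<nu>) * \<tau> n \<le> V powr (1 + 2 * i * \<nu>) * \<tau> n"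
    using H pos assms(5) X.tail_pos[of n] by (intro mult_right_mono powr_mono2) auto
  then have "H powr (1 + 2 * i * \<nu>) * \<tau> n \<le> 1"
    using V by linarith
  then show "H * \<tau> n \<le> H powr (- 2 * i * \<nu>)"
    using pos by (simp add: powr_add powr_minus field_simps)
  have "U powr (1 - 2 * j * \<nu>) \<le> H powr (1 - 2 * j * \<nu>)"
    using H assms(6) X.pos[OF assms(1)] assms(2) by (intro powr_mono2) auto
  then have "2 * real (A n) \<le> H powr (1 - 2 * j * \<nu>)"
    using U by linarith
  then show "2 * real (A n) / H \<le> H powr (- 2 * j * \<nu>)"
    using pos by (simp add: powr_diff powr_minus field_simps)
qed (use assms in auto)

lemma simultaneous_between_B:
  assumes "1 \<le> n" and "real (B n) \<le> U" and "U \<le> H" and "H \<le> V"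
    and "0 \<le> 1 + 2 * j * \<nu>" and "0 \<le> 1 - 2 * i * \<nu>"
    and "V powr (1 + 2 * j * \<nu>) * \<sigma> n \<le> 1"
    and "2 * real (B n) \<le> U powr (1 - 2 * i * \<nu>)"
  shows "simultaneous_solvable i j (\<xi>, \<eta>) \<nu> H"
proof -
  interpret swapped: unit_fraction_pair B A T S
    using disjoint by unfold_locales auto
  show ?thesis
    using assms by (intro simultaneous_solvable_swap[OF swapped.simultaneous_between_A])
qed

text \<open>The first two bounds force every solution to be a common multiple of \<open>A m\<close> and \<open>B n\<close>, hence of their
  product. Its errors are then at least those of the product itself, one of which is too large.\<close>

lemma not_simultaneous_solvable:
  assumes mn: "1 \<le> m" "1 \<le> n"
    and A: "real (A m) * H powr (- 2 * i * \<nu>) + H * (real (A m) * \<tau> m) < 1"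
    and B: "real (B n) * H powr (- 2 * j * \<nu>) + H * (real (B n) * \<sigma> n) < 1"
    and large: "H powr (- 2 * i * \<nu>) < real (A m) * real (B n) * \<tau> m \<or>
      H powr (- 2 * j * \<nu>) < real (A m) * real (B n) * \<sigma> n"
  shows "\<not> simultaneous_solvable i j (\<xi>, \<eta>) \<nu> H"
proof
  assume "simultaneous_solvable i j (\<xi>, \<eta>) \<nu> H"
  then obtain p1 p2 q :: int where q: "q \<noteq> 0" "\<bar>of_int q\<bar> \<le> H"
    and p1: "\<bar>of_int q * \<xi> - of_int p1\<bar> \<le> H powr (- 2 * i * \<nu>)"
    and p2: "\<bar>of_int q * \<eta> - of_int p2\<bar> \<le> H powr (- 2 * j * \<nu>)"
    unfolding simultaneous_solvable_def by auto
  note tails = X.tail_pos[of m] Y.tail_pos[of n]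
  have "real (A m) * \<bar>of_int q * \<xi> - of_int p1\<bar> + \<bar>of_int q\<bar> * (real (A m) * \<tau> m)
      \<le> real (A m) * H powr (- 2 * i * \<nu>) + H * (real (A m) * \<tau> m)"
    using p1 q tails by (intro add_mono mult_left_mono mult_right_mono) auto
  then have X: "int (A m) dvd q" "of_int q * \<xi> - of_int p1 = of_int q * \<tau> m"
    using X.rational_approximation_dvd[OF mn(1), of q p1] A by simp_all
  have "real (B n) * \<bar>of_int q * \<eta> - of_int p2\<bar> + \<bar>of_int q\<bar> * (real (B n) * \<sigma> n)
      \<le> real (B n) * H powr (- 2 * j * \<nu>) + H * (real (B n) * \<sigma> n)"
    using p2 q tails by (intro add_mono mult_left_mono mult_right_mono) auto
  then have Y: "int (B n) dvd q" "of_int q * \<eta> - of_int p2 = of_int q * \<sigma> n"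
    using Y.rational_approximation_dvd[OF mn(2), of q p2] B by simp_all
  have "int (A m) * int (B n) dvd q"
    using X(1) Y(1) coprime_A_B[OF mn] by (intro divides_mult) simp_all
  then have "int (A m) * int (B n) \<le> \<bar>q\<bar>"
    using q(1) by (simp add: zdvd_imp_le)
  then have "real_of_int (int (A m) * int (B n)) \<le> of_int \<bar>q\<bar>"
    by (simp only: of_int_le_iff)
  then have le: "real (A m) * real (B n) \<le> \<bar>of_int q\<bar>"
    by simp
  have "real (A m) * real (B n) * \<tau> m \<le> \<bar>of_int q\<bar> * \<tau> m"
       "real (A m) * real (B n) * \<sigma> n \<le> \<bar>of_int q\<bar> * \<sigma> n"
    using le tails by (intro mult_right_mono; simp)+
  then show False
    using large p1 p2 tails unfolding X(2) Y(2) abs_mult by linarith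
qed

end

section \<open>Growth relative to the first sequence\<close>

text \<open>All orders are taken relative to \<open>ln (A n)\<close>, so that \<open>A n\<close> has order \<open>1\<close>.\<close>

locale mu_R_pair = unit_fraction_pair A B S T
  for A B :: "nat \<Rightarrow> nat" and S T :: "nat set" +
  fixes \<mu> R :: real
  assumes mu_gt_1: "1 < \<mu>" and R_gt_1: "1 < R"
    and A_ratio: "(\<lambda>n. ln (real (A (Suc n))) / ln (real (A n))) \<longlonglongrightarrow> \<mu>"
    and B_ratio: "(\<lambda>n. ln (real (B (Suc n))) / ln (real (B n))) \<longlonglongrightarrow> \<mu>"
    and B_A_ratio: "(\<lambda>n. ln (real (B n)) / ln (real (A n))) \<longlonglongrightarrow> R"
begin

abbreviation ord :: "(nat \<Rightarrow> real) \<Rightarrow> real \<Rightarrow> bool" where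
  "ord \<equiv> has_order (\<lambda>n. ln (real (A n)))"

lemma scale: "filterlim (\<lambda>n. ln (real (A n))) at_top sequentially"
  by (rule filterlim_compose[OF ln_at_top X.A_at_top])

lemma A_pos_eventually: "\<forall>\<^sub>F n in sequentially. 0 < real (A n)"
  and B_pos_eventually: "\<forall>\<^sub>F n in sequentially. 0 < real (B n)"
  using X.A_at_top Y.A_at_top by (simp_all only: filterlim_at_top_dense)

lemma ord_A: "ord (\<lambda>n. real (A n)) 1"
proof -
  have "\<forall>\<^sub>F n in sequentially. 0 < ln (real (A n))"
    using scale by (simp add: filterlim_at_top_dense)
  then have "\<forall>\<^sub>F n in sequentially. 1 = ln (real (A n)) / ln (real (A n))"
    by eventually_elim simp
  then show ?thesis
    unfolding has_order_def using A_pos_eventually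
    by (auto intro: Lim_transform_eventually[OF tendsto_const])
qed

lemma ord_B: "ord (\<lambda>n. real (B n)) R"
  unfolding has_order_def using B_pos_eventually B_A_ratio by simp

lemma ord_A_Suc: "ord (\<lambda>n. real (A (Suc n))) \<mu>"
  unfolding has_order_def using A_pos_eventually A_ratio
  by (simp add: eventually_sequentially_Suc[of "\<lambda>n. 0 < A n"])

lemma ord_B_Suc: "ord (\<lambda>n. real (B (Suc n))) (\<mu> * R)"
  unfolding has_order_def
proof
  show "\<forall>\<^sub>F n in sequentially. 0 < real (B (Suc n))"
    using B_pos_eventually by (simp add: eventually_sequentially_Suc[of "\<lambda>n. 0 < B n"])
  have "\<forall>\<^sub>F n in sequentially. 1 < real (B n)"
    using Y.A_at_top by (simp only: filterlim_at_top_dense)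
  then have "\<forall>\<^sub>F n in sequentially. ln (real (B (Suc n))) / ln (real (B n))
      * (ln (real (B n)) / ln (real (A n))) = ln (real (B (Suc n))) / ln (real (A n))"
    by eventually_elim simp
  then show "(\<lambda>n. ln (real (B (Suc n))) / ln (real (A n))) \<longlonglongrightarrow> \<mu> * R"
    by (rule Lim_transform_eventually[OF tendsto_mult[OF B_ratio B_A_ratio]])
qed

lemma ord_A_Suc_Suc: "ord (\<lambda>n. real (A (Suc (Suc n)))) (\<mu> * \<mu>)"
  unfolding has_order_def
proof
  have A_Suc: "\<forall>\<^sub>F n in sequentially. 1 < real (A (Suc n))"
    using filterlim_compose[OF X.A_at_top filterlim_Suc] by (simp only: filterlim_at_top_dense o_def)
  have "\<forall>\<^sub>F n in sequentially. 0 < A (Suc n)"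
    using has_order_pos[OF ord_A_Suc] by simp
  then show "\<forall>\<^sub>F n in sequentially. 0 < real (A (Suc (Suc n)))"
    by (simp add: eventually_sequentially_Suc[of "\<lambda>n. 0 < A (Suc n)"])
  have "\<forall>\<^sub>F n in sequentially. ln (real (A (Suc (Suc n)))) / ln (real (A (Suc n)))
      * (ln (real (A (Suc n))) / ln (real (A n))) = ln (real (A (Suc (Suc n)))) / ln (real (A n))"
    using A_Suc by eventually_elim simp
  then show "(\<lambda>n. ln (real (A (Suc (Suc n)))) / ln (real (A n))) \<longlonglongrightarrow> \<mu> * \<mu>"
    by (rule Lim_transform_eventually[OF tendsto_mult[OF LIMSEQ_Suc[OF A_ratio] A_ratio]])
qed

lemma ord_one: "ord (\<lambda>_. 1) 0" and ord_two: "ord (\<lambda>_. 2) 0"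
  by (simp_all add: has_order_const scale)

lemma ord_tail:
  assumes "ord f c" and "\<And>n. 1 / f n \<le> g n" and "\<And>n. g n \<le> 2 / f n"
  shows "ord g (- c)"
proof (rule has_order_squeeze[OF scale])
  show "ord (\<lambda>n. 1 / f n) (- c)" "ord (\<lambda>n. 2 / f n) (- c)"
    using has_order_divide[OF ord_one assms(1)] has_order_divide[OF ord_two assms(1)] by simp_all
qed (use assms in auto)

lemma ord_\<tau>: "ord \<tau> (- \<mu>)"
  and ord_\<tau>_Suc: "ord (\<lambda>n. \<tau> (Suc n)) (- (\<mu> * \<mu>))"
  and ord_\<sigma>: "ord \<sigma> (- (\<mu> * R))"
  by (rule ord_tail[OF ord_A_Suc] ord_tail[OF ord_A_Suc_Suc] ord_tail[OF ord_B_Suc],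
      rule X.tail_bounds Y.tail_bounds, rule X.tail_bounds Y.tail_bounds)+

text \<open>These rules compute the order of a product or power by resolution. The numerical facts in the later
  proofs therefore keep the unsimplified shape, such as \<open>0 - (1 + R)\<close>, in which the exponents arise.\<close>

lemmas orders = ord_one ord_two ord_A ord_A_Suc ord_A_Suc_Suc ord_B ord_B_Suc ord_\<tau> ord_\<tau>_Suc ord_\<sigma>
  has_order_mult has_order_divide has_order_powr

lemma ord_less:
  assumes "ord f c" and "ord g d" and "c < d"
  shows "\<forall>\<^sub>F n in sequentially. f n < g n"
  using assms by (rule has_order_eventually_less[OF scale])

text \<open>A sum is as large as its largest summand on this scale; the factor \<open>2\<close> lost in comparing each summand
  with half of the bound is invisible.\<close>

lemma ord_sum_less:
  assumes "ord f c" and "ord g d" and h: "ord h e" and "c < e" and "d < e"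
  shows "\<forall>\<^sub>F n in sequentially. f n + g n < h n"
proof -
  have half: "ord (\<lambda>n. h n / 2) e"
    using has_order_divide[OF h ord_two] by simp
  show ?thesis
    using ord_less[OF assms(1) half assms(4)] ord_less[OF assms(2) half assms(5)]
    by eventually_elim simp
qed

lemma ord_sum3_less:
  assumes "ord f c" and "ord g d" and "ord k b" and h: "ord h e" and "c < e" and "d < e" and "b < e"
  shows "\<forall>\<^sub>F n in sequentially. f n + g n + k n < h n"
proof -
  have half: "ord (\<lambda>n. h n / 2) e"
    using has_order_divide[OF h ord_two] by simp
  show ?thesis
    using ord_sum_less[OF assms(1,2) half assms(5,6)] ord_less[OF assms(3) half assms(7)]
    by eventually_elim simp
qed

lemma ord_at_top: "ord f c \<Longrightarrow> 0 < c \<Longrightarrow> filterlim f at_top sequentially"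
  by (rule has_order_at_top[OF scale])

end

locale twisted_pair = mu_R_pair +
  fixes i j :: real
  assumes weights: "j \<le> i" "i + j = 1"
    and mu_gt_2: "2 < \<mu>"
    and R_upper: "R < j * (\<mu> - 2)"
    and R_lower: "\<mu> / (\<mu> - 2) < R"
    and R_lower_i: "\<mu> / (i * (\<mu> - 1)) < R"
begin

lemma j_pos: "0 < j" and i_pos: "0 < i"
proof -
  have "0 < j * (\<mu> - 2)"
    using R_upper R_gt_1 by linarith
  then show "0 < j"
    using mu_gt_2 by (simp add: zero_less_mult_iff)
  then show "0 < i"
    using weights by linarith
qed

lemma R_lower': "\<mu> < (\<mu> - 2) * R"
  using R_lower mu_gt_2 by (simp add: field_simps)

lemma R_lower_i': "\<mu> / i < (\<mu> - 1) * R"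
  using R_lower_i mu_gt_2 i_pos by (simp add: field_simps)

lemma two_R_add_two_less: "2 * R + 2 < \<mu>"
proof -
  have "j * (\<mu> - 2) \<le> 1 / 2 * (\<mu> - 2)"
    using weights mu_gt_2 by (intro mult_right_mono) auto
  then show ?thesis
    using R_upper by (simp add: field_simps)
qed

lemma mu_R_gt: "\<mu> + 2 * R < \<mu> * R"
  using R_lower' by (simp add: algebra_simps)

text \<open>These compare the ranges allowed for the two coefficients: when \<open>H powr (2 * j)\<close> has order \<open>R\<close>, the order
  of \<open>H powr (2 * i)\<close> is \<open>i / j * R\<close>, and when \<open>H powr (2 * i)\<close> has order \<open>\<mu>\<close>, that of \<open>H powr (2 * j)\<close> is \<open>j / i * \<mu>\<close>.
  The third bound restates the upper bound on \<open>R\<close>, the second the lower bound that involves \<open>i\<close>.\<close>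

lemma ratio_bounds: "j / i \<le> 1" "j / i * \<mu> < (\<mu> - 1) * R - \<mu>"  "i / j * R < \<mu> - 2 - R"
proof -
  show "j / i \<le> 1"
    using weights i_pos by simp
  have "j / i = 1 / i - 1"
    using weights i_pos by (simp add: field_simps)
  then have "j / i * \<mu> = \<mu> / i - \<mu>"
    by (simp only: left_diff_distrib) simp
  then show "j / i * \<mu> < (\<mu> - 1) * R - \<mu>"
    using R_lower_i' by simp
  have "i / j = 1 / j - 1"
    using weights j_pos by (simp add: field_simps)
  then have "i / j * R = R / j - R"
    by (simp only: left_diff_distrib) simp
  moreover have "R / j < \<mu> - 2"
    using R_upper j_pos by (simp add: field_simps)
  ultimately show "i / j * R < \<mu> - 2 - R"
    by simp
qed

section \<open>The uniform exponent of the linear form\<close>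

text \<open>The block from \<open>A n powr (1 / (2 * i))\<close> to the next such value is cut at \<open>B n powr (1 / (2 * j))\<close>. The form
  with coefficient \<open>A n\<close> serves the left part and the one with coefficient \<open>B n\<close> the right part; each is
  tested at the right end of its part, which yields one term of the minimum.\<close>

lemma omega_hat_lower:
  assumes "0 < \<nu>" and A: "\<nu> < 2 * j * ((\<mu> - 1) / R)" and B: "\<nu> < 2 * i * ((\<mu> - 1) / \<mu>) * R"
  shows "\<forall>\<^sub>F H in at_top. linear_form_solvable i j (\<xi>, \<eta>) \<nu> H"
proof -
  let ?X = "\<lambda>n. real (A n) powr (1 / (2 * i))" and ?Y = "\<lambda>n. real (B n) powr (1 / (2 * j))"
  have num: "1 + - \<mu> < - \<nu> * (1 / (2 * j) * R)" "R + - (\<mu> * R) < - \<nu> * (1 / (2 * i) * \<mu>)"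
    using A B i_pos j_pos R_gt_1 mu_gt_1 by (simp_all add: field_simps)
  have "filterlim ?X at_top sequentially"
    by (rule ord_at_top, (rule orders)+) (use i_pos in simp)
  moreover have "\<forall>\<^sub>F n in sequentially. \<forall>H. ?X n \<le> H \<and> H \<le> ?X (Suc n) \<longrightarrow>
      linear_form_solvable i j (\<xi>, \<eta>) \<nu> H"
  proof -
    have "\<forall>\<^sub>F n in sequentially. real (A n) * \<tau> n < ?Y n powr (- \<nu>)"
      by (rule ord_less, (rule orders)+) (rule num)
    moreover have "\<forall>\<^sub>F n in sequentially. real (B n) * \<sigma> n < ?X (Suc n) powr (- \<nu>)"
      by (rule ord_less, (rule orders)+) (rule num)
    ultimately show ?thesis
      using eventually_ge_at_top[of 1] A_pos_eventually
    proof (eventually_elim, intro allI impI)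
      fix n H
      assume A_small: "real (A n) * \<tau> n < ?Y n powr (- \<nu>)"
        and B_small: "real (B n) * \<sigma> n < ?X (Suc n) powr (- \<nu>)" and n: "1 \<le> n"
        and "0 < real (A n)" and H: "?X n \<le> H \<and> H \<le> ?X (Suc n)"
      then have "0 < ?X n"
        by simp
      then have H_pos: "0 < H"
        using H by linarith
      show "linear_form_solvable i j (\<xi>, \<eta>) \<nu> H"
      proof (cases "H \<le> ?Y n")
        case True
        then have "?Y n powr (- \<nu>) \<le> H powr (- \<nu>)"
          using \<open>0 < \<nu>\<close> H_pos by (intro powr_mono2') auto
        moreover have "real (A n) \<le> H powr (2 * i)"
          using H i_pos by (intro le_powr_of_root_le) auto
        ultimately show ?thesis
          using n A_small by (intro linear_form_solvable_A) auto
      next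
        case False
        have "?X (Suc n) powr (- \<nu>) \<le> H powr (- \<nu>)"
          using \<open>0 < \<nu>\<close> H_pos H by (intro powr_mono2') auto
        moreover have "real (B n) \<le> H powr (2 * j)"
          using False j_pos by (intro le_powr_of_root_le) auto
        ultimately show ?thesis
          using n B_small by (intro linear_form_solvable_B) auto
      qed
    qed
  qed
  ultimately show ?thesis
    by (rule eventually_at_top_by_cover)
qed

text \<open>Take \<open>H\<close> so small that \<open>B n\<close> is not yet available, but only just. At level \<open>(n, n)\<close>, a form that vanishes
  at the rational point is then a multiple of the one with coefficient \<open>A n\<close>, of order \<open>1 - \<mu>\<close>; the others have
  order at least \<open>-(1 + R)\<close>, which is larger.\<close>

lemma omega_hat_upper_A:
  assumes "2 * j * ((\<mu> - 1) / R) < \<nu>"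
  shows "\<not> (\<forall>\<^sub>F H in at_top. linear_form_solvable i j (\<xi>, \<eta>) \<nu> H)"
proof (rule not_eventually_at_top_by_sequence)
  let ?H = "\<lambda>n. (real (B n) / 2) powr (1 / (2 * j))"
  have \<nu>: "\<mu> - 1 < \<nu> * (1 / (2 * j) * R)"
    using assms j_pos R_gt_1 by (simp add: field_simps)
  have i: "2 * i * (1 / (2 * j) * R) < \<mu> - 2 - R"
    using ratio_bounds(3) by simp
  have j: "2 * j * (1 / (2 * j) * R) = R"
    using j_pos by simp
  have num: "- \<nu> * (1 / (2 * j) * (R - 0)) < 0 - (1 + R)"
    "2 * i * (1 / (2 * j) * (R - 0)) + - \<mu> < 0 - (1 + R)"
    "2 * j * (1 / (2 * j) * (R - 0)) + - (\<mu> * R) < 0 - (1 + R)"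
    "- \<nu> * (1 / (2 * j) * (R - 0)) < 1 + - \<mu>"
    "2 * j * (1 / (2 * j) * (R - 0)) + - (\<mu> * R) < 1 + - \<mu>"
    unfolding diff_0_right mult_minus_left j using \<nu> i two_R_add_two_less mu_R_gt R_gt_1 by linarith+
  show "filterlim ?H at_top sequentially"
    by (rule ord_at_top, (rule orders)+) (use j_pos R_gt_1 in simp)
  have "\<forall>\<^sub>F n in sequentially. ?H n powr (- \<nu>) + ?H n powr (2 * i) * \<tau> n + ?H n powr (2 * j) * \<sigma> n
      < 1 / (real (A n) * real (B n))"
    by (rule ord_sum3_less, (rule orders)+) (rule num)+
  moreover have "\<forall>\<^sub>F n in sequentially. ?H n powr (- \<nu>) + ?H n powr (2 * j) * \<sigma> n
      < real (A n) * \<tau> n"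
    by (rule ord_sum_less, (rule orders)+) (rule num)+
  ultimately show "\<forall>\<^sub>F n in sequentially. \<not> linear_form_solvable i j (\<xi>, \<eta>) \<nu> (?H n)"
    using eventually_ge_at_top[of 1]
  proof eventually_elim
    case (elim n)
    have "?H n powr (2 * j) = real (B n) / 2"
      using j_pos by (simp add: powr_powr)
    then have "\<not> real (B n) \<le> ?H n powr (2 * j)"
      using Y.pos[OF elim(3)] by simp
    then show ?case
      using elim by (intro not_linear_form_solvable[of n n]) auto
  qed
qed

text \<open>Here \<open>H\<close> stops just short of the coefficient \<open>A (Suc n)\<close>. At level \<open>(n + 1, n)\<close> the competitors of the
  form with coefficient \<open>B n\<close> have order at least \<open>-(\<mu> + R)\<close>, and \<open>\<mu> + R < (\<mu> - 1) * R\<close>.\<close>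

lemma omega_hat_upper_B:
  assumes "2 * i * ((\<mu> - 1) / \<mu>) * R < \<nu>"
  shows "\<not> (\<forall>\<^sub>F H in at_top. linear_form_solvable i j (\<xi>, \<eta>) \<nu> H)"
proof (rule not_eventually_at_top_by_sequence)
  let ?H = "\<lambda>n. (real (A (Suc n)) / 2) powr (1 / (2 * i))"
  have \<nu>: "\<mu> * R - R < \<nu> * (1 / (2 * i) * \<mu>)"
    using assms i_pos mu_gt_1 by (simp add: field_simps)
  have j: "2 * j * (1 / (2 * i) * \<mu>) < \<mu> * R - R - \<mu>"
    using ratio_bounds(2) by (simp add: left_diff_distrib)
  have i: "2 * i * (1 / (2 * i) * \<mu>) = \<mu>"
    using i_pos by simp
  have mm: "2 * \<mu> + R < \<mu> * \<mu>"
  proof -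
    have "4 * \<mu> < \<mu> * \<mu>"
      using two_R_add_two_less R_gt_1 by (intro mult_strict_right_mono) auto
    then show ?thesis
      using two_R_add_two_less R_gt_1 by linarith
  qed
  have num: "- \<nu> * (1 / (2 * i) * (\<mu> - 0)) < 0 - (\<mu> + R)"
    "2 * i * (1 / (2 * i) * (\<mu> - 0)) + - (\<mu> * \<mu>) < 0 - (\<mu> + R)"
    "2 * j * (1 / (2 * i) * (\<mu> - 0)) + - (\<mu> * R) < 0 - (\<mu> + R)"
    "- \<nu> * (1 / (2 * i) * (\<mu> - 0)) < R + - (\<mu> * R)"
    unfolding diff_0_right mult_minus_left i using \<nu> j two_R_add_two_less mu_R_gt mm R_gt_1 by linarith+
  show "filterlim ?H at_top sequentially"
    by (rule ord_at_top, (rule orders)+) (use i_pos mu_gt_1 in simp)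
  have "\<forall>\<^sub>F n in sequentially. ?H n powr (- \<nu>) + ?H n powr (2 * i) * \<tau> (Suc n) + ?H n powr (2 * j) * \<sigma> n
      < 1 / (real (A (Suc n)) * real (B n))"
    by (rule ord_sum3_less, (rule orders)+) (rule num)+
  moreover have "\<forall>\<^sub>F n in sequentially. ?H n powr (- \<nu>) < real (B n) * \<sigma> n"
    by (rule ord_less, (rule orders)+) (rule num)+
  ultimately show "\<forall>\<^sub>F n in sequentially. \<not> linear_form_solvable i j (\<xi>, \<eta>) \<nu> (?H n)"
    using eventually_ge_at_top[of 1]
  proof eventually_elim
    case (elim n)
    have "?H n powr (2 * i) = real (A (Suc n)) / 2"
      using i_pos by (simp add: powr_powr)
    then have "\<not> real (A (Suc n)) \<le> ?H n powr (2 * i)"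
      using X.pos[of "Suc n"] by simp
    then show ?case
      using elim by (intro not_linear_form_solvable[of "Suc n" n]) auto
  qed
qed


section \<open>The ordinary exponent of the linear form\<close>

text \<open>The form with coefficient \<open>A n\<close> is best relative to \<open>H\<close> at the moment when it becomes admissible.\<close>

lemma omega_lower:
  assumes "\<nu> < 2 * i * (\<mu> - 1)"
  shows "\<exists>\<^sub>F H in at_top. linear_form_solvable i j (\<xi>, \<eta>) \<nu> H"
  unfolding frequently_def
proof (rule not_eventually_at_top_by_sequence)
  let ?H = "\<lambda>n. real (A n) powr (1 / (2 * i))"
  have num: "1 + - \<mu> < - \<nu> * (1 / (2 * i) * 1)"
    using assms i_pos by (simp add: field_simps)
  show "filterlim ?H at_top sequentially"
    by (rule ord_at_top, (rule orders)+) (use i_pos in simp)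
  have "\<forall>\<^sub>F n in sequentially. real (A n) * \<tau> n < ?H n powr (- \<nu>)"
    by (rule ord_less, (rule orders)+) (rule num)
  then show "\<forall>\<^sub>F n in sequentially. \<not> \<not> linear_form_solvable i j (\<xi>, \<eta>) \<nu> (?H n)"
    using eventually_ge_at_top[of 1]
  proof eventually_elim
    case (elim n)
    have "real (A n) \<le> ?H n powr (2 * i)"
      using i_pos by (simp add: powr_powr)
    then show ?case
      using elim linear_form_solvable_A[of n "?H n" i \<nu> j] by simp
  qed
qed

text \<open>Every large \<open>H\<close> has to be excluded. Measured by the order \<open>s\<close> of \<open>H powr (2 * i)\<close>, a block runs from \<open>1\<close> to \<open>\<mu>\<close>.
  At level \<open>(n, n)\<close> the remainders have to stay negligible, which bounds \<open>s\<close> from above; at level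
  \<open>(n + 1, n)\<close> the larger denominator has to be paid for, which requires \<open>\<mu> + R \<le> (\<mu> - 1) * s\<close>. The value \<open>s = 2\<close>
  satisfies both conditions, so the block is cut there.\<close>

lemma omega_upper:
  assumes "2 * i * (\<mu> - 1) < \<nu>"
  shows "\<not> (\<exists>\<^sub>F H in at_top. linear_form_solvable i j (\<xi>, \<eta>) \<nu> H)"
  unfolding not_frequently
proof (rule eventually_at_top_by_cover)
  \<comment> \<open>The factor \<open>1 / 2\<close> keeps the coefficient \<open>A (Suc n)\<close> out of reach on the whole block.\<close>
  let ?X = "\<lambda>n. (real (A n) / 2) powr (1 / (2 * i))"
  let ?V = "\<lambda>n. real (A n) powr (1 / i)"
  let ?A = "\<lambda>n. real (A n) powr (1 / (2 * i))" and ?B = "\<lambda>n. real (B n) powr (1 / (2 * j))"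
  have "0 < 2 * i * (\<mu> - 1)"
    using i_pos mu_gt_1 by simp
  then have \<nu>_pos: "0 < \<nu>"
    using assms by linarith
  have \<nu>_i: "\<mu> - 1 < \<nu> * (1 / (2 * i))"
    using assms i_pos by (simp add: field_simps)
  have "\<nu> * (1 / (2 * i)) \<le> \<nu> * (1 / (2 * j))"
    using \<nu>_pos weights j_pos by (intro mult_left_mono divide_left_mono) auto
  then have "(\<mu> - 1) * R < \<nu> * (1 / (2 * j)) * R"
    using \<nu>_i R_gt_1 by (intro mult_strict_right_mono) auto
  then have \<nu>_j: "- \<nu> * (1 / (2 * j) * R) < R + - (\<mu> * R)"
    unfolding left_diff_distrib mult_minus_left mult.assoc by linarith
  have \<nu>_i': "2 * (\<mu> - 1) < \<nu> * (1 / i)"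
    using \<nu>_i by simp
  have ji: "2 * j * (1 / i * 1) \<le> 2" "2 * j * (1 / (2 * i) * \<mu>) < \<mu> * R - R - \<mu>"
    using ratio_bounds by (simp_all add: left_diff_distrib)
  have ii: "2 * i * (1 / i * 1) = 2" "2 * i * (1 / (2 * i) * \<mu>) = \<mu>"
    using i_pos by simp_all
  have mm: "4 * \<mu> < \<mu> * \<mu>"
    using two_R_add_two_less R_gt_1 by (intro mult_strict_right_mono) auto
  note facts = \<nu>_i \<nu>_i' ji ii mm two_R_add_two_less mu_R_gt R_gt_1
  have num: "- \<nu> * (1 / (2 * i) * (1 - 0)) < 0 - (1 + R)"
    "2 * i * (1 / i * 1) + - \<mu> < 0 - (1 + R)"
    "2 * j * (1 / i * 1) + - (\<mu> * R) < 0 - (1 + R)"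
    "- \<nu> * (1 / (2 * i) * 1) < 1 + - \<mu>"
    "2 * j * (1 / i * 1) + - (\<mu> * R) < 1 + - \<mu>"
    "- \<nu> * (1 / i * 1) < 0 - (\<mu> + R)"
    "2 * i * (1 / (2 * i) * (\<mu> - 0)) + - (\<mu> * \<mu>) < 0 - (\<mu> + R)"
    "2 * j * (1 / (2 * i) * (\<mu> - 0)) + - (\<mu> * R) < 0 - (\<mu> + R)"
    unfolding diff_0_right mult_minus_left ii using facts by linarith+
  show "filterlim ?X at_top sequentially"
    by (rule ord_at_top, (rule orders)+) (use i_pos in simp)
  have "\<forall>\<^sub>F n in sequentially. ?X n powr (- \<nu>) + ?V n powr (2 * i) * \<tau> n + ?V n powr (2 * j) * \<sigma> n
      < 1 / (real (A n) * real (B n))"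
    by (rule ord_sum3_less, (rule orders)+) (rule num)+
  moreover have "\<forall>\<^sub>F n in sequentially. ?A n powr (- \<nu>) + ?V n powr (2 * j) * \<sigma> n
      < real (A n) * \<tau> n"
    by (rule ord_sum_less, (rule orders)+) (rule num)+
  moreover have "\<forall>\<^sub>F n in sequentially. ?B n powr (- \<nu>) < real (B n) * \<sigma> n"
    by (rule ord_less, (rule orders)+) (rule \<nu>_j)
  moreover have "\<forall>\<^sub>F n in sequentially. ?V n powr (- \<nu>) + ?X (Suc n) powr (2 * i) * \<tau> (Suc n)
      + ?X (Suc n) powr (2 * j) * \<sigma> n < 1 / (real (A (Suc n)) * real (B n))"
    by (rule ord_sum3_less, (rule orders)+) (rule num)+
  ultimately show "\<forall>\<^sub>F n in sequentially. \<forall>H. ?X n \<le> H \<and> H \<le> ?X (Suc n) \<longrightarrow>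
      \<not> linear_form_solvable i j (\<xi>, \<eta>) \<nu> H"
    using eventually_ge_at_top[of 1]
  proof (eventually_elim, intro allI impI)
    fix n H
    assume low: "?X n powr (- \<nu>) + ?V n powr (2 * i) * \<tau> n + ?V n powr (2 * j) * \<sigma> n
        < 1 / (real (A n) * real (B n))"
      and A: "?A n powr (- \<nu>) + ?V n powr (2 * j) * \<sigma> n < real (A n) * \<tau> n"
      and B: "?B n powr (- \<nu>) < real (B n) * \<sigma> n"
      and high: "?V n powr (- \<nu>) + ?X (Suc n) powr (2 * i) * \<tau> (Suc n)
        + ?X (Suc n) powr (2 * j) * \<sigma> n < 1 / (real (A (Suc n)) * real (B n))"
      and n: "1 \<le> n" and H: "?X n \<le> H \<and> H \<le> ?X (Suc n)"
    have pos: "0 < real (A n)" "0 < real (B n)" "0 < real (A (Suc n))"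
      using X.pos[of n] X.pos[of "Suc n"] Y.pos[of n] n by auto
    have X_pos: "0 < ?X n"
      using pos by simp
    then have H_pos: "0 < H"
      using H by linarith
    have antimono: "H powr (- \<nu>) \<le> U powr (- \<nu>)" if "0 < U" "U \<le> H" for U
      using that \<nu>_pos by (intro powr_mono2') auto
    have tail_mono: "H powr r * t \<le> V powr r * t" if "H \<le> V" "0 < r" "0 < t" for V r t
      using that H_pos by (intro mult_right_mono powr_mono2) auto
    note tails = X.tail_pos[of n] X.tail_pos[of "Suc n"] Y.tail_pos[of n]
    have B': "H powr (- \<nu>) < real (B n) * \<sigma> n" if "real (B n) \<le> H powr (2 * j)"
    proof -
      have "?B n \<le> H"
        using that j_pos H_pos by (intro root_le_of_le_powr) auto
      then have "H powr (- \<nu>) \<le> ?B n powr (- \<nu>)"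
        using pos by (intro antimono) auto
      then show ?thesis
        using B by linarith
    qed
    show "\<not> linear_form_solvable i j (\<xi>, \<eta>) \<nu> H"
    proof (cases "H \<le> ?V n")
      case True
      have V: "H powr (2 * i) * \<tau> n \<le> ?V n powr (2 * i) * \<tau> n"
        "H powr (2 * j) * \<sigma> n \<le> ?V n powr (2 * j) * \<sigma> n"
        using True i_pos j_pos tails by (intro tail_mono; simp)+
      have "H powr (- \<nu>) + H powr (2 * j) * \<sigma> n < real (A n) * \<tau> n"
        if "real (A n) \<le> H powr (2 * i)"
      proof -
        have "?A n \<le> H"
          using that i_pos H_pos by (intro root_le_of_le_powr) auto
        then have "H powr (- \<nu>) \<le> ?A n powr (- \<nu>)"
          using pos by (intro antimono) auto
        then show ?thesis
          using A V by linarith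
      qed
      moreover have "H powr (- \<nu>) + H powr (2 * i) * \<tau> n + H powr (2 * j) * \<sigma> n
          < 1 / (real (A n) * real (B n))"
        using low antimono[OF X_pos] H V by linarith
      ultimately show ?thesis
        using n B' by (intro not_linear_form_solvable) auto
    next
      case False
      have X: "H powr (2 * i) * \<tau> (Suc n) \<le> ?X (Suc n) powr (2 * i) * \<tau> (Suc n)"
        "H powr (2 * j) * \<sigma> n \<le> ?X (Suc n) powr (2 * j) * \<sigma> n"
        using H i_pos j_pos tails by (intro tail_mono; simp)+
      have V: "H powr (- \<nu>) \<le> ?V n powr (- \<nu>)"
        using False pos by (intro antimono) auto
      have "H powr (2 * i) \<le> ?X (Suc n) powr (2 * i)"
        using H H_pos i_pos by (intro powr_mono2) auto
      also have "\<dots> = real (A (Suc n)) / 2"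
        using i_pos by (simp add: powr_powr)
      finally have "\<not> real (A (Suc n)) \<le> H powr (2 * i)"
        using pos by simp
      moreover have "H powr (- \<nu>) + H powr (2 * i) * \<tau> (Suc n) + H powr (2 * j) * \<sigma> n
          < 1 / (real (A (Suc n)) * real (B n))"
        using high X V by linarith
      ultimately show ?thesis
        using n B' by (intro not_linear_form_solvable) auto
    qed
  qed
qed

section \<open>The uniform exponent of simultaneous approximation\<close>

text \<open>On the block from \<open>A\<^sub>n B\<^sub>n\<close> to \<open>A\<^sub>n\<^sub>+\<^sub>1 B\<^sub>n\<^sub>+\<^sub>1\<close> four families take turns: the denominator \<open>A\<^sub>n B\<^sub>n\<close>, multiples of \<open>B\<^sub>n\<close>,
  the denominator \<open>A\<^sub>n\<^sub>+\<^sub>1 B\<^sub>n\<close>, multiples of \<open>A\<^sub>n\<^sub>+\<^sub>1\<close>. The changes take place at the orders \<open>\<mu> - 1\<close>, \<open>\<mu> + R\<close> and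
  \<open>(\<mu> - 1) R\<close>. The first and the last of them are tight, for \<open>\<theta>\<^sub>1\<close> and \<open>\<theta>\<^sub>2\<close> respectively; the remaining
  conditions hold with room to spare.\<close>

lemma lambda_hat_lower:
  assumes "0 < \<nu>" and A: "\<nu> < 1 / (2 * i) * (1 - R / (\<mu> - 1))"
    and B: "\<nu> < 1 / (2 * j) * (1 - \<mu> / ((\<mu> - 1) * R))"
  shows "\<forall>\<^sub>F H in at_top. simultaneous_solvable i j (\<xi>, \<eta>) \<nu> H"
proof -
  define x y where "x = 2 * i * \<nu>" and "y = 2 * j * \<nu>"
  let ?X = "\<lambda>n. real (A n) * real (B n)" and ?Y = "\<lambda>n. real (A (Suc n)) * real (B n)"
  let ?X' = "\<lambda>n. real (A (Suc n)) * real (B (Suc n))"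
  let ?U = "\<lambda>n. real (A n) powr (\<mu> - 1)" and ?W = "\<lambda>n. real (A n) powr ((\<mu> - 1) * R)"
  have xy: "0 < x" "0 < y" and xy': "- 2 * i * \<nu> = - x" "- 2 * j * \<nu> = - y"
    using assms i_pos j_pos by (simp_all add: x_def y_def)
  have m: "0 < \<mu> - 1" and mR: "0 < (\<mu> - 1) * R"
    using mu_gt_1 R_gt_1 by simp_all
  have x': "x < 1 - R / (\<mu> - 1)" and y': "y < 1 - \<mu> / ((\<mu> - 1) * R)"
    using A B i_pos j_pos by (simp_all add: x_def y_def field_simps)
  have eqs: "(1 - R / (\<mu> - 1)) * (\<mu> - 1) = \<mu> - 1 - R"
    "(1 - \<mu> / ((\<mu> - 1) * R)) * ((\<mu> - 1) * R) = (\<mu> - 1) * R - \<mu>"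
    using m R_gt_1 by (simp_all only: left_diff_distrib) simp_all
  have x: "x * (\<mu> - 1) < \<mu> - 1 - R"
    using mult_strict_right_mono[OF x' m] eqs by linarith
  have y: "y * ((\<mu> - 1) * R) < (\<mu> - 1) * R - \<mu>"
    using mult_strict_right_mono[OF y' mR] eqs by linarith
  have lt1: "x < 1" "y < 1"
  proof -
    have "0 < R / (\<mu> - 1)" "0 < \<mu> / ((\<mu> - 1) * R)"
      using m mR R_gt_1 mu_gt_1 by simp_all
    then show "x < 1" "y < 1"
      using x' y' by linarith+
  qed
  have num1: "1 + R + - \<mu> < - x * ((\<mu> - 1) * 1)"
    using x unfolding mult_1_right mult_minus_left by linarith
  have num2: "1 + R + - (\<mu> * R) < - y * ((\<mu> - 1) * 1)"
  proof -
    have "y * (\<mu> - 1) < 1 * (\<mu> - 1)"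
      using lt1 m by (intro mult_strict_right_mono)
    then show ?thesis
      using mu_R_gt R_gt_1 unfolding mult_1_right mult_1 mult_minus_left by linarith
  qed
  have num3: "0 + R < (1 - x) * ((\<mu> - 1) * 1)"
    using x unfolding left_diff_distrib[of 1 x] mult_1_right mult_1 by linarith
  have num4: "(1 + y) * (\<mu> + R) + - (\<mu> * R) < 0"
  proof -
    have "y * (\<mu> + R) \<le> y * ((\<mu> - 1) * R)"
      using xy mu_R_gt by (intro mult_left_mono) (auto simp: algebra_simps)
    then have "y * (\<mu> + R) < (\<mu> - 1) * R - \<mu>"
      using y by linarith
    then show ?thesis
      by (simp add: algebra_simps)
  qed
  have num5: "\<mu> + R + - (\<mu> * \<mu>) < - x * ((\<mu> - 1) * R * 1)"
  proof -
    have "x * (\<mu> - 1) * R < (\<mu> - 1 - R) * R"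
      using x R_gt_1 by (intro mult_strict_right_mono) auto
    moreover have "(\<mu> - 1 - R) * R = \<mu> * R - R - R * R" "x * ((\<mu> - 1) * R) = x * (\<mu> - 1) * R"
      by (simp_all only: algebra_simps)
    moreover have "\<mu> * R \<le> \<mu> * (\<mu> - 1)"
      using two_R_add_two_less R_gt_1 by (intro mult_left_mono) auto
    moreover have "\<mu> * (\<mu> - 1) = \<mu> * \<mu> - \<mu>" "0 < R * R"
      using R_gt_1 by (simp_all add: algebra_simps)
    ultimately show ?thesis
      unfolding mult_1_right mult_minus_left by linarith
  qed
  have num6: "\<mu> + R + - (\<mu> * R) < - y * ((\<mu> - 1) * R * 1)"
    using y unfolding mult_1_right mult_minus_left by (simp add: algebra_simps)
  have num7: "0 + \<mu> < (1 - y) * ((\<mu> - 1) * R * 1)"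
    using y unfolding left_diff_distrib[of 1 y] mult_1_right mult_1 by linarith
  have num8: "(1 + x) * (\<mu> + \<mu> * R) + - (\<mu> * \<mu>) < 0"
  proof -
    have "x * (1 + R) \<le> x * (\<mu> - 1)"
      using xy two_R_add_two_less R_gt_1 by (intro mult_left_mono) auto
    then have "x * (1 + R) * \<mu> < (\<mu> - 1 - R) * \<mu>"
      using x mu_gt_1 by (intro mult_strict_right_mono) auto
    then show ?thesis
      by (simp add: algebra_simps)
  qed
  have num9: "R < (\<mu> - 1) * 1" "\<mu> < (\<mu> - 1) * R * 1"
    using two_R_add_two_less R_gt_1 mu_R_gt by (simp_all add: algebra_simps)
  show ?thesis
  proof (rule eventually_at_top_by_cover)
    show "filterlim ?X at_top sequentially"
      by (rule ord_at_top, (rule orders)+) (use R_gt_1 in simp)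
    have "\<forall>\<^sub>F n in sequentially. ?X n * \<tau> n < ?U n powr - x"
         "\<forall>\<^sub>F n in sequentially. ?X n * \<sigma> n < ?U n powr - y"
         "\<forall>\<^sub>F n in sequentially. 2 * real (B n) < ?U n powr (1 - x)"
         "\<forall>\<^sub>F n in sequentially. ?Y n powr (1 + y) * \<sigma> n < 1"
         "\<forall>\<^sub>F n in sequentially. ?Y n * \<tau> (Suc n) < ?W n powr - x"
         "\<forall>\<^sub>F n in sequentially. ?Y n * \<sigma> n < ?W n powr - y"
         "\<forall>\<^sub>F n in sequentially. 2 * real (A (Suc n)) < ?W n powr (1 - y)"
         "\<forall>\<^sub>F n in sequentially. ?X' n powr (1 + x) * \<tau> (Suc n) < 1"
         "\<forall>\<^sub>F n in sequentially. real (B n) < ?U n"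
         "\<forall>\<^sub>F n in sequentially. real (A (Suc n)) < ?W n"
      by (rule ord_less, (rule orders)+, rule num1 num2 num3 num4 num5 num6 num7 num8 num9)+
    then show "\<forall>\<^sub>F n in sequentially. \<forall>H. ?X n \<le> H \<and> H \<le> ?X (Suc n) \<longrightarrow>
        simultaneous_solvable i j (\<xi>, \<eta>) \<nu> H"
      using eventually_ge_at_top[of 1]
    proof (eventually_elim, intro allI impI)
      fix n H
      assume AB: "?X n * \<tau> n < ?U n powr - x" "?X n * \<sigma> n < ?U n powr - y"
        and B_plane: "2 * real (B n) < ?U n powr (1 - x)" "?Y n powr (1 + y) * \<sigma> n < 1"
        and A'B: "?Y n * \<tau> (Suc n) < ?W n powr - x" "?Y n * \<sigma> n < ?W n powr - y"
        and A_plane: "2 * real (A (Suc n)) < ?W n powr (1 - y)" "?X' n powr (1 + x) * \<tau> (Suc n) < 1"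
        and start: "real (B n) < ?U n" "real (A (Suc n)) < ?W n"
        and n: "1 \<le> n" and H: "?X n \<le> H \<and> H \<le> ?X (Suc n)"
      consider "H \<le> ?U n" | "?U n \<le> H" "H \<le> ?Y n" | "?Y n \<le> H" "H \<le> ?W n" | "?W n \<le> H"
        by linarith
      then show "simultaneous_solvable i j (\<xi>, \<eta>) \<nu> H"
      proof cases
        case 1
        then show ?thesis
          using AB n H \<open>0 < \<nu>\<close> i_pos j_pos xy' by (intro simultaneous_until[of n n H "?U n"]) simp_all
      next
        case 2
        then show ?thesis
          using B_plane start n lt1 xy
          by (intro simultaneous_between_B[of n "?U n" H "?Y n"]) (simp_all add: x_def y_def)
      next
        case 3
        then show ?thesis
          using A'B n \<open>0 < \<nu>\<close> i_pos j_pos xy' by (intro simultaneous_until[of "Suc n" n H "?W n"]) simp_all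
      next
        case 4
        then show ?thesis
          using A_plane start n lt1 xy H
          by (intro simultaneous_between_A[of "Suc n" "?W n" H "?X' n"]) (simp_all add: x_def y_def)
      qed
    qed
  qed
qed

text \<open>The choice of \<open>H\<close>, of order \<open>\<mu> - 1\<close>, makes \<open>H * (A n * \<tau> n)\<close> equal to \<open>1 / 2\<close>: it is the largest height, up to a
  constant, at which approximations to \<open>\<theta>\<^sub>1\<close> are still forced to have denominators divisible by \<open>A n\<close>.\<close>

lemma lambda_hat_upper_A:
  assumes "1 / (2 * i) * (1 - R / (\<mu> - 1)) < \<nu>"
  shows "\<not> (\<forall>\<^sub>F H in at_top. simultaneous_solvable i j (\<xi>, \<eta>) \<nu> H)"
proof (rule not_eventually_at_top_by_sequence)
  let ?H = "\<lambda>n. 1 / (2 * (real (A n) * \<tau> n))"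
  have m: "0 < \<mu> - 1"
    using mu_gt_1 by simp
  have "1 - R / (\<mu> - 1) < 2 * i * \<nu>"
    using assms i_pos by (simp add: field_simps)
  moreover have "(1 - R / (\<mu> - 1)) * (\<mu> - 1) = \<mu> - 1 - R"
    using m mu_gt_1 R_gt_1 by (simp only: left_diff_distrib) simp
  ultimately have x: "\<mu> - 1 - R < 2 * i * \<nu> * (\<mu> - 1)"
    using m by (metis mult_strict_right_mono)
  \<comment> \<open>The requirement on \<open>\<theta>\<^sub>2\<close> is strong enough to force divisibility by \<open>B n\<close> as well.\<close>
  have y: "R < 2 * j * \<nu> * (\<mu> - 1)"
  proof -
    have "R = j / i * (i / j * R)"
      using i_pos j_pos by simp
    also have "\<dots> < j / i * (2 * i * \<nu> * (\<mu> - 1))"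
      using ratio_bounds(3) x i_pos j_pos by (intro mult_strict_left_mono) auto
    finally show ?thesis
      using i_pos by simp
  qed
  show "filterlim ?H at_top sequentially"
    by (rule ord_at_top, (rule orders)+) (use m in simp)
  have h: "0 - (0 + (1 + - \<mu>)) = \<mu> - 1"
    by simp
  have num: "0 + (1 + (- 2 * i * \<nu>) * (0 - (0 + (1 + - \<mu>)))) < 0"
    "R + (- 2 * j * \<nu>) * (0 - (0 + (1 + - \<mu>))) < 0"
    "0 - (0 + (1 + - \<mu>)) + (R + - (\<mu> * R)) < 0"
    "- 2 * i * \<nu> * (0 - (0 + (1 + - \<mu>))) < 1 + R + - \<mu>"
    unfolding h mult_minus_left using x y two_R_add_two_less mu_R_gt R_gt_1 by linarith+
  have "\<forall>\<^sub>F n in sequentially. 2 * (real (A n) * ?H n powr (- 2 * i * \<nu>)) < 1"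
    by (rule ord_less, (rule orders)+) (rule num)
  moreover have "\<forall>\<^sub>F n in sequentially. real (B n) * ?H n powr (- 2 * j * \<nu>)
      + ?H n * (real (B n) * \<sigma> n) < 1"
    by (rule ord_sum_less, (rule orders)+) (rule num)+
  moreover have "\<forall>\<^sub>F n in sequentially. ?H n powr (- 2 * i * \<nu>) < real (A n) * real (B n) * \<tau> n"
    by (rule ord_less, (rule orders)+) (rule num)+
  ultimately show "\<forall>\<^sub>F n in sequentially. \<not> simultaneous_solvable i j (\<xi>, \<eta>) \<nu> (?H n)"
    using eventually_ge_at_top[of 1]
  proof eventually_elim
    case (elim n)
    have "?H n * (real (A n) * \<tau> n) = 1 / 2"
      using X.pos[OF elim(4)] X.tail_pos[of n] by simp
    then have "real (A n) * ?H n powr (- 2 * i * \<nu>) + ?H n * (real (A n) * \<tau> n) < 1"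
      using elim(1) by linarith
    then show ?case
      using elim by (intro not_simultaneous_solvable[of n n]) auto
  qed
qed

text \<open>The mirror image for \<open>\<theta>\<^sub>2\<close> and level \<open>(n + 1, n)\<close>, with \<open>H\<close> of order \<open>(\<mu> - 1) R\<close>.\<close>

lemma lambda_hat_upper_B:
  assumes "1 / (2 * j) * (1 - \<mu> / ((\<mu> - 1) * R)) < \<nu>"
  shows "\<not> (\<forall>\<^sub>F H in at_top. simultaneous_solvable i j (\<xi>, \<eta>) \<nu> H)"
proof (rule not_eventually_at_top_by_sequence)
  let ?H = "\<lambda>n. 1 / (2 * (real (B n) * \<sigma> n))"
  have m: "0 < (\<mu> - 1) * R"
    using mu_gt_1 R_gt_1 by simp
  have "1 - \<mu> / ((\<mu> - 1) * R) < 2 * j * \<nu>"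
    using assms j_pos by (simp add: field_simps)
  moreover have "(1 - \<mu> / ((\<mu> - 1) * R)) * ((\<mu> - 1) * R) = (\<mu> - 1) * R - \<mu>"
    using m mu_gt_1 R_gt_1 by (simp only: left_diff_distrib) simp
  ultimately have y: "(\<mu> - 1) * R - \<mu> < 2 * j * \<nu> * ((\<mu> - 1) * R)"
    using m by (metis mult_strict_right_mono)
  \<comment> \<open>The requirement on \<open>\<theta>\<^sub>1\<close> forces divisibility by \<open>A (Suc n)\<close>.\<close>
  have x: "\<mu> < 2 * i * \<nu> * ((\<mu> - 1) * R)"
  proof -
    have "\<mu> = i / j * (j / i * \<mu>)"
      using i_pos j_pos by simp
    also have "\<dots> < i / j * (2 * j * \<nu> * ((\<mu> - 1) * R))"
      using ratio_bounds(2) y i_pos j_pos by (intro mult_strict_left_mono) auto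
    finally show ?thesis
      using j_pos by simp
  qed
  have h: "0 - (0 + (R + - (\<mu> * R))) = (\<mu> - 1) * R"
    by (simp add: algebra_simps)
  have expand: "(\<mu> - 1) * R = \<mu> * R - R"
    by (simp add: algebra_simps)
  have mm: "\<mu> * R \<le> \<mu> * (\<mu> - 2)"
    using two_R_add_two_less mu_gt_1 R_gt_1 by (intro mult_left_mono) auto
  show "filterlim ?H at_top sequentially"
    by (rule ord_at_top, (rule orders)+) (use m h in simp)
  have num: "\<mu> + (- 2 * i * \<nu>) * (0 - (0 + (R + - (\<mu> * R)))) < 0"
    "0 - (0 + (R + - (\<mu> * R))) + (\<mu> + - (\<mu> * \<mu>)) < 0"
    "0 + (R + (- 2 * j * \<nu>) * (0 - (0 + (R + - (\<mu> * R))))) < 0"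
    "- 2 * j * \<nu> * (0 - (0 + (R + - (\<mu> * R)))) < \<mu> + R + - (\<mu> * R)"
    unfolding h mult_minus_left using x y mm mu_R_gt R_gt_1 mu_gt_1 expand
    by (simp_all only: right_diff_distrib)
  have "\<forall>\<^sub>F n in sequentially. real (A (Suc n)) * ?H n powr (- 2 * i * \<nu>)
      + ?H n * (real (A (Suc n)) * \<tau> (Suc n)) < 1"
    by (rule ord_sum_less, (rule orders)+) (rule num)+
  moreover have "\<forall>\<^sub>F n in sequentially. 2 * (real (B n) * ?H n powr (- 2 * j * \<nu>)) < 1"
    by (rule ord_less, (rule orders)+) (rule num)
  moreover have "\<forall>\<^sub>F n in sequentially. ?H n powr (- 2 * j * \<nu>) < real (A (Suc n)) * real (B n) * \<sigma> n"
    by (rule ord_less, (rule orders)+) (rule num)+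
  ultimately show "\<forall>\<^sub>F n in sequentially. \<not> simultaneous_solvable i j (\<xi>, \<eta>) \<nu> (?H n)"
    using eventually_ge_at_top[of 1]
  proof eventually_elim
    case (elim n)
    have "?H n * (real (B n) * \<sigma> n) = 1 / 2"
      using Y.pos[OF elim(4)] Y.tail_pos[of n] by simp
    then have "real (B n) * ?H n powr (- 2 * j * \<nu>) + ?H n * (real (B n) * \<sigma> n) < 1"
      using elim(2) by linarith
    then show ?case
      using elim by (intro not_simultaneous_solvable[of "Suc n" n]) auto
  qed
qed

end

section \<open>The values of the exponents\<close>

lemma twisted_pair_of_mu_R_sequences:
  assumes "mu_R_sequences \<mu> R A B" and "j \<le> i" "i + j = 1" "2 < \<mu>" "R < j * (\<mu> - 2)"
    "\<mu> / (\<mu> - 2) < R" "\<mu> / (i * (\<mu> - 1)) < R"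
  shows "\<exists>S T. twisted_pair A B S T \<mu> R i j"
proof -
  obtain S T where ST: "S \<noteq> {}" "T \<noteq> {}" "S \<inter> T = {}"
    and primes: "\<forall>p\<in>S. prime p" "\<forall>q\<in>T. prime q"
    and factors: "\<forall>n\<ge>1. prime_factors (A n) \<subseteq> S \<and> prime_factors (B n) \<subseteq> T"
    and valuations:
      "\<forall>p\<in>S. strict_mono_on {1..} (\<lambda>n. multiplicity p (A n)) \<and> (\<forall>n\<ge>1. 0 < multiplicity p (A n))"
      "\<forall>q\<in>T. strict_mono_on {1..} (\<lambda>n. multiplicity q (B n)) \<and> (\<forall>n\<ge>1. 0 < multiplicity q (B n))"
    using assms(1) unfolding mu_R_sequences_def by (elim conjE exE) (rule that; assumption)
  have mu_R: "1 < \<mu>" "1 < R" and pos: "\<And>n. 1 \<le> n \<Longrightarrow> 0 < A n" "\<And>n. 1 \<le> n \<Longrightarrow> 0 < B n"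
    and limits: "(\<lambda>n. ln (real (A (Suc n))) / ln (real (A n))) \<longlonglongrightarrow> \<mu>"
      "(\<lambda>n. ln (real (B (Suc n))) / ln (real (B n))) \<longlonglongrightarrow> \<mu>"
      "(\<lambda>n. ln (real (B n)) / ln (real (A n))) \<longlonglongrightarrow> R"
    using assms(1) unfolding mu_R_sequences_def by (simp_all only: Suc_eq_plus1)
  have "twisted_pair A B S T \<mu> R i j"
    using ST primes factors valuations mu_R pos limits assms(2-)
    by (intro twisted_pair.intro twisted_pair_axioms.intro mu_R_pair.intro mu_R_pair_axioms.intro
        unit_fraction_pair.intro unit_fraction_pair_axioms.intro unit_fraction_series.intro; blast)
  then show ?thesis
    by blast
qed

theorem theorem3:
  fixes i j \<mu> R :: real and A B :: "nat \<Rightarrow> nat" and \<theta> :: "real \<times> real"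
  assumes "0 \<le> i" and "0 \<le> j" and "i \<ge> j" and "i + j = 1"
    and "\<mu> > 2" and "R < j * (\<mu> - 2)" and "R > \<mu> / (\<mu> - 2)" and "R > \<mu> / (i * (\<mu> - 1))"
    and "mu_R_sequences \<mu> R A B"
    and "\<theta> = (\<Sum>n. 1 / real (A (Suc n)), \<Sum>n. 1 / real (B (Suc n)))"
  shows "omega_hat i j \<theta> = ereal (min (2 * j * ((\<mu> - 1) / R)) (2 * i * ((\<mu> - 1) / \<mu>) * R))
    \<and> lambda_hat i j \<theta> = ereal (min (1 / (2 * i) * (1 - R / (\<mu> - 1)))
                                      (1 / (2 * j) * (1 - \<mu> / ((\<mu> - 1) * R))))
    \<and> omega_exp i j \<theta> = ereal (2 * i * (\<mu> - 1))"
proof -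
  obtain S T where "twisted_pair A B S T \<mu> R i j"
    using twisted_pair_of_mu_R_sequences[OF assms(9)] assms by blast
  then interpret twisted_pair A B S T \<mu> R i j .
  have \<theta>: "\<theta> = (\<xi>, \<eta>)"
    by (simp add: assms(10) X.value_of_series_def Y.value_of_series_def)
  have pos: "0 < 2 * j * ((\<mu> - 1) / R)" "0 < 2 * i * ((\<mu> - 1) / \<mu>) * R" "0 < 2 * i * (\<mu> - 1)"
    using i_pos j_pos mu_gt_1 R_gt_1 by simp_all
  have "R < \<mu> - 1" "\<mu> < (\<mu> - 1) * R" "0 < (\<mu> - 1) * R"
    using two_R_add_two_less mu_R_gt R_gt_1 mu_gt_1 by (simp_all add: algebra_simps)
  then have pos': "0 < 1 / (2 * i) * (1 - R / (\<mu> - 1))" "0 < 1 / (2 * j) * (1 - \<mu> / ((\<mu> - 1) * R))"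
    using i_pos j_pos mu_gt_1 by (simp_all add: divide_less_eq)
  show ?thesis
    unfolding \<theta> omega_hat_def lambda_hat_def omega_exp_def
  proof (intro conjI Sup_ereal_threshold)
    fix \<nu> :: real
    show "\<not> (\<forall>\<^sub>F H in at_top. linear_form_solvable i j (\<xi>, \<eta>) \<nu> H)"
      if "min (2 * j * ((\<mu> - 1) / R)) (2 * i * ((\<mu> - 1) / \<mu>) * R) < \<nu>"
      using that omega_hat_upper_A omega_hat_upper_B unfolding min_less_iff_disj by blast
    show "\<not> (\<forall>\<^sub>F H in at_top. simultaneous_solvable i j (\<xi>, \<eta>) \<nu> H)"
      if "min (1 / (2 * i) * (1 - R / (\<mu> - 1))) (1 / (2 * j) * (1 - \<mu> / ((\<mu> - 1) * R))) < \<nu>"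
      using that lambda_hat_upper_A lambda_hat_upper_B unfolding min_less_iff_disj by blast
    show "\<not> (\<exists>\<^sub>F H in at_top. linear_form_solvable i j (\<xi>, \<eta>) \<nu> H)"
      if "2 * i * (\<mu> - 1) < \<nu>"
      using that by (rule omega_upper)
  qed (use pos pos' in \<open>simp_all only: min_less_iff_conj omega_hat_lower lambda_hat_lower omega_lower\<close>)
qed

end
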